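(* Let $(M^{2n+1},\Phi,\xi,\eta,g)$ be an ACR-manifold of the class of Kenmotsu type, with generalized curvature tensor $B$ (depending on scalars $a_0,a_1,a_2$). On the AG-structure space the components of $B$ are given by 1. $B_{a0b0}=a_1\,r_{ab}$; 2. $B_{\hat a0b0}=-(a_0+2na_1-2a_2s)\,\delta^a_b+a_1\,r_{\hat ab}$; 3. $B_{\hat abcd}=2a_0A^a_{bcd}+a_1\{\delta^a_c\,r_{bd}-\delta^a_d\,r_{bc}\}$; 4. $B_{\hat abc\hat d}=a_0\left(A^{ad}_{bc}-B^{ah}{}_{c}\,B_{bh}{}^{d}\right)+a_1\{\delta^a_cQ^d_b+\delta^d_bQ^a_c\}+(2a_2s-a_0)\,\delta^a_c\delta^d_b$; 5. $B_{\hat a\hat bcd}=2a_0B^{ab}{}_{[cd]}+4a_1\,\delta^{[a}_{[c}Q^{b]}_{d]}+2(2a_2s-a_0)\,\delta^{[a}_{[c}\delta^{b]}_{d]}$; and the remaining components are identically zero, or are given by the first Bianchi identity, or are conjugate to the components $B_{a0b0}$, $B_{\hat a0b0}$, $B_{\hat abcd}$, $B_{\hat abc\hat d}$, $B_{\hat a\hat bcd}$.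
   Context: ACR-manifold: a smooth manifold $M^{2n+1}$ with an endomorphism $\Phi$ of $X(M)$ (smooth vector fields), $\xi\in X(M)$, a Riemannian metric $g$ and $\eta(\cdot)=g(\cdot,\xi)$ such that $\Phi\xi=0$, $\eta(\xi)=1$, $\eta\circ\Phi=0$, $\Phi^2=-\mathrm{id}+\eta\otimes\xi$, $g(\Phi X,\Phi Y)=g(X,Y)-\eta(X)\eta(Y)$. It is of the class of Kenmotsu type if $\nabla_X(\Phi)Y-\nabla_{\Phi X}(\Phi)\Phi Y=-\eta(Y)\Phi X$ for all $X,Y\in X(M)$ ($\nabla$ the Levi-Civita connection). A-frames and AG-structure space: $a,b,c,d,h\in\{1,\dots,n\}$, $\hat a=a+n$, $\hat{\hat a}=a$, $\hat 0=0$; $i,j,k,l\in\{0,1,\dots,2n\}$; repeated indices are summed. For an orthonormal frame $\{\xi,e_1,\dots,e_n,\Phi e_1,\dots,\Phi e_n\}$ set $\varepsilon_0=\xi$, $\varepsilon_a=\frac1{\sqrt2}(\mathrm{id}-\sqrt{-1}\Phi)e_a$, $\varepsilon_{\hat a}=\frac1{\sqrt2}(\mathrm{id}+\sqrt{-1}\Phi)e_a$. The set of all these (complex) frames is the AG-structure space, and components of tensors are taken in such frames: $g_{00}=1$, $g_{a0}=g_{ab}=g_{\hat a\hat b}=0$, $g_{\hat ab}=\delta^a_b$; $\Phi\varepsilon_a=\sqrt{-1}\varepsilon_a$, $\Phi\varepsilon_{\hat a}=-\sqrt{-1}\varepsilon_{\hat a}$. The conjugate of a component replaces each index $i$ by $\hat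 i$ and takes the complex conjugate. Brackets $[\,\cdot\,\cdot\,]$ denote antisymmetrization with factor $\frac12$. $R(X,Y)Z=R^i_{jkl}X^kY^lZ^j\varepsilon_i$ is the Riemann tensor; for a $(3,1)$-tensor $T$, $T(X,Y,Z,W)=g(T(Z,W)Y,X)$, so $R_{ijkl}=R^{\hat i}_{jkl}$. $r_{jl}=g^{ik}R_{ijkl}$ is the Ricci tensor, $s$ the scalar curvature, $Q$ the Ricci operator, $r(X,Y)=g(X,QY)$. Generalized curvature tensor, with scalars $a_0,a_1,a_2$: $B_{ijkl}=a_0R_{ijkl}+a_1\{g_{ik}r_{jl}-g_{il}r_{jk}+r_{ik}g_{jl}-r_{il}g_{jk}\}+2a_2s\{g_{ik}g_{jl}-g_{il}g_{jk}\}$. It has the algebraic symmetries of a Riemann curvature tensor. Structure functions of the class of Kenmotsu type (distinct from the tensor $B_{ijkl}$): $B^{ab}{}_c$ (first Kirichenko tensor, $B^{ab}{}_c=-B^{ba}{}_c$), with conjugate $B_{ab}{}^c$, is determined in the dual coframe ($\omega=\omega^0$, $\omega_a=\omega^{\hat a}$) by $d\omega^a=\omega^a_b\wedge\omega^b+B^{ab}{}_c\,\omega^c\wedge\omega_b-\omega^a\wedge\omega$, $d\omega_a=-\omega^b_a\wedge\omega_b+B_{ab}{}^c\,\omega_c\wedge\omega^b-\omega_a\wedge\omega$, $d\omega=0$. The functions $A^a_{bcd}$ (antisymmetric in $c,d$), $A^{ad}_{bc}$, $B^{ab}{}_{cd}$, $B^{abd}{}_c$ come from the further structure equations and are related to the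 curvature by the known formulas $R^a_{0c0}=-\delta^a_c$; $R^a_{\hat bcd}=2(B^{ab}{}_{[cd]}-\delta^a_{[c}\delta^b_{d]})$; $R^a_{\hat bc\hat d}=B^{abd}{}_c-B^{ab}{}_hB^{hd}{}_c$; $R^a_{bcd}=2A^a_{bcd}$; $R^a_{bc\hat d}=A^{ad}_{bc}-B^{ah}{}_cB_{bh}{}^d-\delta^a_c\delta^d_b$; the remaining components of $R$ follow by the first Bianchi identity or conjugation or vanish identically. *)

theory Defs
  imports "HOL-Analysis.Analysis"
begin

section \<open>Smooth manifolds\<close>

text \<open>\<open>Ck_on k f S\<close> is used for open \<open>S\<close> only. The derivatives of \<open>f\<close> enter through all
  directional derivatives.\<close>

primrec Ck_on ::
  "nat \<Rightarrow> ('a::euclidean_space \<Rightarrow> 'b::real_normed_vector) \<Rightarrow> 'a set \<Rightarrow> bool" where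
  "Ck_on 0 f S \<longleftrightarrow> continuous_on S f"
| "Ck_on (Suc k) f S \<longleftrightarrow>
     (\<forall>x\<in>S. f differentiable (at x)) \<and>
     (\<forall>v. Ck_on k (\<lambda>x. frechet_derivative f (at x) v) S)"

definition smooth_on ::
  "('a::euclidean_space \<Rightarrow> 'b::real_normed_vector) \<Rightarrow> 'a set \<Rightarrow> bool" where
  "smooth_on f S \<longleftrightarrow> (\<forall>k. Ck_on k f S)"

text \<open>A manifold is a Hausdorff second countable space (given as a whole type) with a smooth
  atlas; its dimension is the dimension of the model space of the charts.\<close>

type_synonym ('m, 'e) chart = "'m set \<times> ('m \<Rightarrow> 'e)"

definition chart_inv :: "('m, 'e) chart \<Rightarrow> 'e \<Rightarrow> 'm" where
  "chart_inv c = inv_into (fst c) (snd c)"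

definition is_chart :: "('m::topological_space, 'e::euclidean_space) chart \<Rightarrow> bool" where
  "is_chart c \<longleftrightarrow> open (fst c) \<and> open (snd c ` fst c) \<and>
     homeomorphism (fst c) (snd c ` fst c) (snd c) (chart_inv c)"

definition smooth_atlas ::
  "('m::{t2_space, second_countable_topology}, 'e::euclidean_space) chart set \<Rightarrow> bool" where
  "smooth_atlas A \<longleftrightarrow>
     (\<forall>c\<in>A. is_chart c) \<and> (\<Union>c\<in>A. fst c) = UNIV \<and>
     (\<forall>c\<in>A. \<forall>c'\<in>A. smooth_on (snd c' \<circ> chart_inv c) (snd c ` (fst c \<inter> fst c')))"

definition smooth_fun ::
  "('m::topological_space, 'e::euclidean_space) chart set \<Rightarrow> 'm set \<Rightarrow> ('m \<Rightarrow> real) \<Rightarrow> bool" where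
  "smooth_fun A U f \<longleftrightarrow> (\<forall>c\<in>A. smooth_on (f \<circ> chart_inv c) (snd c ` (U \<inter> fst c)))"

definition smooth_near ::
  "('m::topological_space, 'e::euclidean_space) chart set \<Rightarrow> 'm \<Rightarrow> ('m \<Rightarrow> real) \<Rightarrow> bool" where
  "smooth_near A p f \<longleftrightarrow> (\<exists>U. open U \<and> p \<in> U \<and> smooth_fun A U f)"


section \<open>Tangent vectors and vector fields\<close>

text \<open>Tangent vectors at \<open>p\<close> are the derivations of germs of smooth functions at \<open>p\<close>; the value
  on functions that are not smooth near \<open>p\<close> is fixed to 0, so that equality of tangent
  vectors is equality of functions.\<close>

type_synonym 'm tvec = "('m \<Rightarrow> real) \<Rightarrow> real"
type_synonym 'm vfield = "'m \<Rightarrow> 'm tvec"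

definition tangent ::
  "('m::topological_space, 'e::euclidean_space) chart set \<Rightarrow> 'm \<Rightarrow> 'm tvec set" where
  "tangent A p = {v.
     (\<forall>f h. smooth_near A p f \<and> smooth_near A p h \<longrightarrow>
        v (\<lambda>q. f q + h q) = v f + v h \<and>
        v (\<lambda>q. f q * h q) = f p * v h + h p * v f) \<and>
     (\<forall>f c. smooth_near A p f \<longrightarrow> v (\<lambda>q. c * f q) = c * v f) \<and>
     (\<forall>f h. smooth_near A p f \<and> (\<forall>\<^sub>F q in nhds p. f q = h q) \<longrightarrow> v f = v h) \<and>
     (\<forall>f. \<not> smooth_near A p f \<longrightarrow> v f = 0)}"

text \<open>\<open>vfield_on A U X\<close>: \<open>X\<close> is a smooth vector field on the open set \<open>U\<close>; the values of \<open>X\<close>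
  outside \<open>U\<close> are irrelevant. The module of global fields is obtained for \<open>U = UNIV\<close>.\<close>

definition vfield_on ::
  "('m::topological_space, 'e::euclidean_space) chart set \<Rightarrow> 'm set \<Rightarrow> 'm vfield \<Rightarrow> bool" where
  "vfield_on A U X \<longleftrightarrow>
     (\<forall>p\<in>U. X p \<in> tangent A p) \<and>
     (\<forall>V f. open V \<and> V \<subseteq> U \<and> smooth_fun A V f \<longrightarrow> smooth_fun A V (\<lambda>p. X p f))"

definition lie_bracket ::
  "('m::topological_space, 'e::euclidean_space) chart set \<Rightarrow>
   'm vfield \<Rightarrow> 'm vfield \<Rightarrow> 'm vfield" where
  "lie_bracket A X Y = (\<lambda>p f. if smooth_near A p f
     then X p (\<lambda>q. Y q f) - Y p (\<lambda>q. X q f) else 0)"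


section \<open>Riemannian metrics, Levi-Civita connection, curvature\<close>

type_synonym 'm metric = "'m \<Rightarrow> 'm tvec \<Rightarrow> 'm tvec \<Rightarrow> real"
type_synonym 'm endo = "'m \<Rightarrow> 'm tvec \<Rightarrow> 'm tvec"
type_synonym 'm connection = "'m vfield \<Rightarrow> 'm vfield \<Rightarrow> 'm vfield"

definition riemannian_metric ::
  "('m::topological_space, 'e::euclidean_space) chart set \<Rightarrow> 'm metric \<Rightarrow> bool" where
  "riemannian_metric A g \<longleftrightarrow>
     (\<forall>p. \<forall>x\<in>tangent A p. \<forall>y\<in>tangent A p. \<forall>z\<in>tangent A p. \<forall>c.
        g p (\<lambda>f. x f + y f) z = g p x z + g p y z \<and>
        g p (\<lambda>f. c * x f) z = c * g p x z \<and>
        g p x y = g p y x) \<and>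
     (\<forall>p. \<forall>x\<in>tangent A p. x \<noteq> (\<lambda>f. 0) \<longrightarrow> g p x x > 0) \<and>
     (\<forall>U X Y. open U \<and> vfield_on A U X \<and> vfield_on A U Y \<longrightarrow>
        smooth_fun A U (\<lambda>p. g p (X p) (Y p)))"

text \<open>An endomorphism of the module of vector fields, i.e. a smooth (1,1)-tensor field, given by
  its values on tangent vectors.\<close>

definition tensor_endo ::
  "('m::topological_space, 'e::euclidean_space) chart set \<Rightarrow> 'm endo \<Rightarrow> bool" where
  "tensor_endo A \<Phi> \<longleftrightarrow>
     (\<forall>p. \<forall>x\<in>tangent A p. \<forall>y\<in>tangent A p. \<forall>c.
        \<Phi> p x \<in> tangent A p \<and>
        \<Phi> p (\<lambda>f. x f + y f) = (\<lambda>f. \<Phi> p x f + \<Phi> p y f) \<and>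
        \<Phi> p (\<lambda>f. c * x f) = (\<lambda>f. c * \<Phi> p x f)) \<and>
     (\<forall>U X. open U \<and> vfield_on A U X \<longrightarrow> vfield_on A U (\<lambda>p. \<Phi> p (X p)))"

text \<open>A connection acts on local vector fields as well: \<open>D\<close> is the Levi-Civita connection of
  \<open>g\<close> if over every open \<open>U\<close> it is an affine connection which is torsion-free and metric.
  For \<open>U = UNIV\<close> these are the usual axioms on global fields; the Levi-Civita connections of
  the open submanifolds are the restrictions of the global one.\<close>

definition levi_civita ::
  "('m::topological_space, 'e::euclidean_space) chart set \<Rightarrow> 'm metric \<Rightarrow> 'm connection \<Rightarrow> bool"
  where
  "levi_civita A g D \<longleftrightarrow> (\<forall>U X Y Z h.
     open U \<and> vfield_on A U X \<and> vfield_on A U Y \<and> vfield_on A U Z \<and> smooth_fun A U h \<longrightarrow>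
       vfield_on A U (D X Y) \<and>
       (\<forall>p\<in>U.
          D (\<lambda>q f. X q f + Y q f) Z p = (\<lambda>f. D X Z p f + D Y Z p f) \<and>
          D X (\<lambda>q f. Y q f + Z q f) p = (\<lambda>f. D X Y p f + D X Z p f) \<and>
          D (\<lambda>q f. h q * X q f) Y p = (\<lambda>f. h p * D X Y p f) \<and>
          D X (\<lambda>q f. h q * Y q f) p = (\<lambda>f. X p h * Y p f + h p * D X Y p f) \<and>
          (\<lambda>f. D X Y p f - D Y X p f) = lie_bracket A X Y p \<and>
          X p (\<lambda>q. g q (Y q) (Z q)) = g p (D X Y p) (Z p) + g p (Y p) (D X Z p)))"

definition cov_endo :: "'m connection \<Rightarrow> 'm endo \<Rightarrow> 'm vfield \<Rightarrow> 'm vfield \<Rightarrow> 'm vfield" where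
  "cov_endo D \<Phi> X Y = (\<lambda>p f. D X (\<lambda>q. \<Phi> q (Y q)) p f - \<Phi> p (D X Y p) f)"


section \<open>ACR-manifolds of the class of Kenmotsu type\<close>

text \<open>The form \<open>\<eta>\<close> is \<open>g p _ (\<xi> p)\<close> throughout.\<close>

definition ACR_manifold ::
  "nat \<Rightarrow> ('m::{t2_space, second_countable_topology}, 'e::euclidean_space) chart set \<Rightarrow>
   'm endo \<Rightarrow> 'm vfield \<Rightarrow> 'm metric \<Rightarrow> bool" where
  "ACR_manifold n A \<Phi> \<xi> g \<longleftrightarrow>
     smooth_atlas A \<and> DIM('e) = 2 * n + 1 \<and>
     tensor_endo A \<Phi> \<and> vfield_on A UNIV \<xi> \<and> riemannian_metric A g \<and>
     (\<forall>p. \<Phi> p (\<xi> p) = (\<lambda>f. 0) \<and> g p (\<xi> p) (\<xi> p) = 1 \<and>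
       (\<forall>x\<in>tangent A p. \<forall>y\<in>tangent A p.
          g p (\<Phi> p x) (\<xi> p) = 0 \<and>
          \<Phi> p (\<Phi> p x) = (\<lambda>f. - x f + g p x (\<xi> p) * \<xi> p f) \<and>
          g p (\<Phi> p x) (\<Phi> p y) = g p x y - g p x (\<xi> p) * g p y (\<xi> p)))"

definition kenmotsu_type ::
  "('m::topological_space, 'e::euclidean_space) chart set \<Rightarrow>
   'm endo \<Rightarrow> 'm vfield \<Rightarrow> 'm metric \<Rightarrow> 'm connection \<Rightarrow> bool" where
  "kenmotsu_type A \<Phi> \<xi> g D \<longleftrightarrow>
     (\<forall>X Y. vfield_on A UNIV X \<and> vfield_on A UNIV Y \<longrightarrow>
       (\<forall>p. (\<lambda>f. cov_endo D \<Phi> X Y p f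
                 - cov_endo D \<Phi> (\<lambda>q. \<Phi> q (X q)) (\<lambda>q. \<Phi> q (Y q)) p f)
            = (\<lambda>f. - g p (Y p) (\<xi> p) * \<Phi> p (X p) f)))"


section \<open>Complexification\<close>

type_synonym 'm ctvec = "('m \<Rightarrow> real) \<Rightarrow> complex"
type_synonym 'm cvfield = "'m \<Rightarrow> 'm ctvec"
type_synonym 'm cform = "'m \<Rightarrow> 'm ctvec \<Rightarrow> complex"

definition ReV :: "'m cvfield \<Rightarrow> 'm vfield" where "ReV Z = (\<lambda>p f. Re (Z p f))"
definition ImV :: "'m cvfield \<Rightarrow> 'm vfield" where "ImV Z = (\<lambda>p f. Im (Z p f))"

definition ctangent ::
  "('m::topological_space, 'e::euclidean_space) chart set \<Rightarrow> 'm \<Rightarrow> 'm ctvec set" where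
  "ctangent A p = {z. (\<lambda>f. Re (z f)) \<in> tangent A p \<and> (\<lambda>f. Im (z f)) \<in> tangent A p}"

definition cvfield_on ::
  "('m::topological_space, 'e::euclidean_space) chart set \<Rightarrow> 'm set \<Rightarrow> 'm cvfield \<Rightarrow> bool" where
  "cvfield_on A U Z \<longleftrightarrow> vfield_on A U (ReV Z) \<and> vfield_on A U (ImV Z)"

text \<open>Complex bilinear extensions of the metric and of operations on pairs of vector fields.\<close>

definition gC :: "'m metric \<Rightarrow> 'm \<Rightarrow> 'm ctvec \<Rightarrow> 'm ctvec \<Rightarrow> complex" where
  "gC g p z w = Complex
     (g p (\<lambda>f. Re (z f)) (\<lambda>f. Re (w f)) - g p (\<lambda>f. Im (z f)) (\<lambda>f. Im (w f)))
     (g p (\<lambda>f. Re (z f)) (\<lambda>f. Im (w f)) + g p (\<lambda>f. Im (z f)) (\<lambda>f. Re (w f)))"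

definition ext2 ::
  "('m vfield \<Rightarrow> 'm vfield \<Rightarrow> 'm vfield) \<Rightarrow> 'm cvfield \<Rightarrow> 'm cvfield \<Rightarrow> 'm cvfield" where
  "ext2 op Z W = (\<lambda>p f. Complex
     (op (ReV Z) (ReV W) p f - op (ImV Z) (ImV W) p f)
     (op (ReV Z) (ImV W) p f + op (ImV Z) (ReV W) p f))"

text \<open>\<open>R(X,Y)Z = \<nabla>\<^sub>X\<nabla>\<^sub>Y Z - \<nabla>\<^sub>Y\<nabla>\<^sub>X Z - \<nabla>\<^bsub>[X,Y]\<^esub> Z\<close> for complex vector fields. This sign is the one
  for which the component \<open>R\<^sup>a\<^sub>0\<^sub>c\<^sub>0\<close> equals \<open>-\<delta>\<^sup>a\<^sub>c\<close> on a manifold of Kenmotsu type.\<close>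

definition curv ::
  "('m::topological_space, 'e::euclidean_space) chart set \<Rightarrow> 'm connection \<Rightarrow>
   'm cvfield \<Rightarrow> 'm cvfield \<Rightarrow> 'm cvfield \<Rightarrow> 'm cvfield" where
  "curv A D X Y Z = (\<lambda>p f.
     ext2 D X (ext2 D Y Z) p f - ext2 D Y (ext2 D X Z) p f
     - ext2 D (ext2 (lie_bracket A) X Y) Z p f)"

definition cform_on ::
  "('m::topological_space, 'e::euclidean_space) chart set \<Rightarrow> 'm set \<Rightarrow> 'm cform \<Rightarrow> bool" where
  "cform_on A U \<alpha> \<longleftrightarrow>
     (\<forall>p\<in>U. \<forall>z\<in>ctangent A p. \<forall>w\<in>ctangent A p. \<forall>c.
        \<alpha> p (\<lambda>f. z f + w f) = \<alpha> p z + \<alpha> p w \<and> \<alpha> p (\<lambda>f. c * z f) = c * \<alpha> p z) \<and>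
     (\<forall>V Z. open V \<and> V \<subseteq> U \<and> cvfield_on A V Z \<longrightarrow>
        smooth_fun A V (\<lambda>p. Re (\<alpha> p (Z p))) \<and> smooth_fun A V (\<lambda>p. Im (\<alpha> p (Z p))))"

definition wedge ::
  "'m cform \<Rightarrow> 'm cform \<Rightarrow> 'm cvfield \<Rightarrow> 'm cvfield \<Rightarrow> 'm \<Rightarrow> complex" where
  "wedge \<alpha> \<beta> X Y p = \<alpha> p (X p) * \<beta> p (Y p) - \<alpha> p (Y p) * \<beta> p (X p)"

definition apply_cfun :: "'m cvfield \<Rightarrow> ('m \<Rightarrow> complex) \<Rightarrow> 'm \<Rightarrow> complex" where
  "apply_cfun Z h p = Z p (\<lambda>q. Re (h q)) + \<i> * Z p (\<lambda>q. Im (h q))"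

definition ext_deriv ::
  "('m::topological_space, 'e::euclidean_space) chart set \<Rightarrow>
   'm cform \<Rightarrow> 'm cvfield \<Rightarrow> 'm cvfield \<Rightarrow> 'm \<Rightarrow> complex" where
  "ext_deriv A \<alpha> X Y p =
     apply_cfun X (\<lambda>q. \<alpha> q (Y q)) p - apply_cfun Y (\<lambda>q. \<alpha> q (X q)) p
     - \<alpha> p (ext2 (lie_bracket A) X Y p)"


section \<open>A-frames\<close>

text \<open>Indices \<open>0\<close>, \<open>a \<in> {1..n}\<close> and \<open>hat n a = a + n\<close>. A section over \<open>U\<close> of the AG-structure space
  is the complex frame \<open>aframe n \<Phi> \<xi> e\<close> of an adapted orthonormal frame \<open>e\<close> over \<open>U\<close>; every
  A-frame at a point is the value of such a section.\<close>

definition hat :: "nat \<Rightarrow> nat \<Rightarrow> nat" where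
  "hat n i = (if i = 0 then 0 else if i \<le> n then i + n else i - n)"

definition rframe :: "nat \<Rightarrow> 'm endo \<Rightarrow> 'm vfield \<Rightarrow> (nat \<Rightarrow> 'm vfield) \<Rightarrow> nat \<Rightarrow> 'm vfield" where
  "rframe n \<Phi> \<xi> e i = (if i = 0 then \<xi> else if i \<le> n then e i else (\<lambda>p. \<Phi> p (e (i - n) p)))"

definition adapted_frame_on ::
  "nat \<Rightarrow> ('m::topological_space, 'e::euclidean_space) chart set \<Rightarrow>
   'm endo \<Rightarrow> 'm vfield \<Rightarrow> 'm metric \<Rightarrow> 'm set \<Rightarrow> (nat \<Rightarrow> 'm vfield) \<Rightarrow> bool" where
  "adapted_frame_on n A \<Phi> \<xi> g U e \<longleftrightarrow>
     (\<forall>a\<in>{1..n}. vfield_on A U (e a)) \<and>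
     (\<forall>p\<in>U.
        (\<forall>i\<le>2*n. \<forall>j\<le>2*n. g p (rframe n \<Phi> \<xi> e i p) (rframe n \<Phi> \<xi> e j p) = of_bool (i = j)) \<and>
        (\<forall>x\<in>tangent A p. \<exists>c. x = (\<lambda>f. \<Sum>i\<le>2*n. c i * rframe n \<Phi> \<xi> e i p f)))"

definition aframe :: "nat \<Rightarrow> 'm endo \<Rightarrow> 'm vfield \<Rightarrow> (nat \<Rightarrow> 'm vfield) \<Rightarrow> nat \<Rightarrow> 'm cvfield" where
  "aframe n \<Phi> \<xi> e i = (\<lambda>p f.
     if i = 0 then of_real (\<xi> p f)
     else if i \<le> n then (of_real (e i p f) - \<i> * of_real (\<Phi> p (e i p) f)) / of_real (sqrt 2)
     else (of_real (e (i - n) p f) + \<i> * of_real (\<Phi> p (e (i - n) p) f)) / of_real (sqrt 2))"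

text \<open>The dual coframe, i.e. the coordinates of a complex tangent vector in the frame \<open>\<epsilon>\<close>.\<close>

definition coframe :: "nat \<Rightarrow> (nat \<Rightarrow> 'm cvfield) \<Rightarrow> nat \<Rightarrow> 'm cform" where
  "coframe n \<epsilon> i p z =
     (THE c. z = (\<lambda>f. \<Sum>j\<le>2*n. c j * \<epsilon> j p f) \<and> (\<forall>j>2*n. c j = 0)) i"


section \<open>Components of tensors in a frame\<close>

text \<open>The frame \<open>\<epsilon>\<close> is an A-frame in all uses. \<open>g_up\<close> is the inverse of the matrix of \<open>g\<close>, whose
  only nonzero entries in an A-frame are \<open>g\<^sub>i\<^sub>j = 1\<close> for \<open>j = hat n i\<close>.\<close>

definition g_lo :: "'m metric \<Rightarrow> (nat \<Rightarrow> 'm cvfield) \<Rightarrow> 'm \<Rightarrow> nat \<Rightarrow> nat \<Rightarrow> complex" where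
  "g_lo g \<epsilon> p i j = gC g p (\<epsilon> i p) (\<epsilon> j p)"

definition g_up :: "nat \<Rightarrow> nat \<Rightarrow> nat \<Rightarrow> complex" where
  "g_up n i j = of_bool (j = hat n i)"

text \<open>\<open>R_up i j k l\<close> is \<open>R\<^sup>i\<^sub>j\<^sub>k\<^sub>l\<close>, and \<open>R_lo i j k l\<close> is
  \<open>R\<^sub>i\<^sub>j\<^sub>k\<^sub>l = g(R(\<epsilon>\<^sub>k,\<epsilon>\<^sub>l)\<epsilon>\<^sub>j,\<epsilon>\<^sub>i)\<close>.\<close>

definition R_up ::
  "nat \<Rightarrow> ('m::topological_space, 'e::euclidean_space) chart set \<Rightarrow> 'm connection \<Rightarrow>
   (nat \<Rightarrow> 'm cvfield) \<Rightarrow> 'm \<Rightarrow> nat \<Rightarrow> nat \<Rightarrow> nat \<Rightarrow> nat \<Rightarrow> complex" where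
  "R_up n A D \<epsilon> p i j k l = coframe n \<epsilon> i p (curv A D (\<epsilon> k) (\<epsilon> l) (\<epsilon> j) p)"

definition R_lo ::
  "('m::topological_space, 'e::euclidean_space) chart set \<Rightarrow> 'm metric \<Rightarrow> 'm connection \<Rightarrow>
   (nat \<Rightarrow> 'm cvfield) \<Rightarrow> 'm \<Rightarrow> nat \<Rightarrow> nat \<Rightarrow> nat \<Rightarrow> nat \<Rightarrow> complex" where
  "R_lo A g D \<epsilon> p i j k l = gC g p (curv A D (\<epsilon> k) (\<epsilon> l) (\<epsilon> j) p) (\<epsilon> i p)"

definition ricci ::
  "nat \<Rightarrow> ('m::topological_space, 'e::euclidean_space) chart set \<Rightarrow> 'm metric \<Rightarrow> 'm connection \<Rightarrow>
   (nat \<Rightarrow> 'm cvfield) \<Rightarrow> 'm \<Rightarrow> nat \<Rightarrow> nat \<Rightarrow> complex" where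
  "ricci n A g D \<epsilon> p j l = (\<Sum>i\<le>2*n. \<Sum>k\<le>2*n. g_up n i k * R_lo A g D \<epsilon> p i j k l)"

text \<open>\<open>ricci_op i j\<close> is \<open>Q\<^sup>i\<^sub>j\<close>: the identity \<open>r(X,Y) = g(X,QY)\<close> reads \<open>r\<^sub>k\<^sub>j = g\<^sub>k\<^sub>i Q\<^sup>i\<^sub>j\<close>.\<close>

definition ricci_op ::
  "nat \<Rightarrow> ('m::topological_space, 'e::euclidean_space) chart set \<Rightarrow> 'm metric \<Rightarrow> 'm connection \<Rightarrow>
   (nat \<Rightarrow> 'm cvfield) \<Rightarrow> 'm \<Rightarrow> nat \<Rightarrow> nat \<Rightarrow> complex" where
  "ricci_op n A g D \<epsilon> p i j = (\<Sum>k\<le>2*n. g_up n i k * ricci n A g D \<epsilon> p k j)"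

definition scalar_curv ::
  "nat \<Rightarrow> ('m::topological_space, 'e::euclidean_space) chart set \<Rightarrow> 'm metric \<Rightarrow> 'm connection \<Rightarrow>
   (nat \<Rightarrow> 'm cvfield) \<Rightarrow> 'm \<Rightarrow> complex" where
  "scalar_curv n A g D \<epsilon> p = (\<Sum>j\<le>2*n. \<Sum>l\<le>2*n. g_up n j l * ricci n A g D \<epsilon> p j l)"

definition gen_curv ::
  "nat \<Rightarrow> ('m::topological_space, 'e::euclidean_space) chart set \<Rightarrow> 'm metric \<Rightarrow> 'm connection \<Rightarrow>
   real \<Rightarrow> real \<Rightarrow> real \<Rightarrow>
   (nat \<Rightarrow> 'm cvfield) \<Rightarrow> 'm \<Rightarrow> nat \<Rightarrow> nat \<Rightarrow> nat \<Rightarrow> nat \<Rightarrow> complex" where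
  "gen_curv n A g D a0 a1 a2 \<epsilon> p i j k l =
    (let G = g_lo g \<epsilon> p; r = ricci n A g D \<epsilon> p; s = scalar_curv n A g D \<epsilon> p in
       of_real a0 * R_lo A g D \<epsilon> p i j k l
     + of_real a1 * (G i k * r j l - G i l * r j k + r i k * G j l - r i l * G j k)
     + 2 * of_real a2 * s * (G i k * G j l - G i l * G j k))"


section \<open>Structure functions\<close>

definition alt2 :: "(nat \<Rightarrow> nat \<Rightarrow> complex) \<Rightarrow> nat \<Rightarrow> nat \<Rightarrow> complex" where
  "alt2 F c d = (F c d - F d c) / 2"

definition kd :: "nat \<Rightarrow> nat \<Rightarrow> complex" where
  "kd a b = of_bool (a = b)"

text \<open>The first group of structure equations over \<open>U\<close>, for some forms \<open>W a b = \<omega>\<^sup>a\<^sub>b\<close>. Here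
  \<open>Bs a b c = B\<^sup>a\<^sup>b\<^sub>c\<close>, its conjugate is \<open>B\<^sub>a\<^sub>b\<^sup>c\<close>, and \<open>\<omega>\<^sub>a\<close> is the coframe element of index
  \<open>hat n a\<close>. Together with antisymmetry of \<open>Bs\<close> in the upper indices these equations determine \<open>Bs\<close>.\<close>

definition first_structure_eqs ::
  "nat \<Rightarrow> ('m::topological_space, 'e::euclidean_space) chart set \<Rightarrow> 'm set \<Rightarrow>
   (nat \<Rightarrow> 'm cvfield) \<Rightarrow> (nat \<Rightarrow> nat \<Rightarrow> nat \<Rightarrow> 'm \<Rightarrow> complex) \<Rightarrow> bool" where
  "first_structure_eqs n A U \<epsilon> Bs \<longleftrightarrow>
     (\<exists>W. (\<forall>a\<in>{1..n}. \<forall>b\<in>{1..n}. cform_on A U (W a b)) \<and>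
       (\<forall>X Y. cvfield_on A U X \<and> cvfield_on A U Y \<longrightarrow> (\<forall>p\<in>U.
         let \<omega> = coframe n \<epsilon> in
         (\<forall>a\<in>{1..n}.
            ext_deriv A (\<omega> a) X Y p =
              (\<Sum>b=1..n. wedge (W a b) (\<omega> b) X Y p)
              + (\<Sum>b=1..n. \<Sum>c=1..n. Bs a b c p * wedge (\<omega> c) (\<omega> (hat n b)) X Y p)
              - wedge (\<omega> a) (\<omega> 0) X Y p \<and>
            ext_deriv A (\<omega> (hat n a)) X Y p =
              - (\<Sum>b=1..n. wedge (W b a) (\<omega> (hat n b)) X Y p)
              + (\<Sum>b=1..n. \<Sum>c=1..n. cnj (Bs a b c p) * wedge (\<omega> (hat n c)) (\<omega> b) X Y p)
              - wedge (\<omega> (hat n a)) (\<omega> 0) X Y p) \<and>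
         ext_deriv A (\<omega> 0) X Y p = 0)))"

text \<open>The structure functions in the A-frame \<open>\<epsilon>\<close> over \<open>U\<close>:
  \<open>Bs a b c = B\<^sup>a\<^sup>b\<^sub>c\<close>, \<open>As a b c d = A\<^sup>a\<^sub>b\<^sub>c\<^sub>d\<close>, \<open>At a d b c = A\<^sup>a\<^sup>d\<^sub>b\<^sub>c\<close>,
  \<open>Bt a b c d = B\<^sup>a\<^sup>b\<^sub>c\<^sub>d\<close>, \<open>Bu a b d c = B\<^sup>a\<^sup>b\<^sup>d\<^sub>c\<close>. All but \<open>Bs\<close> are fixed by their relation to the
  curvature (\<open>Bt\<close> up to a part symmetric in the lower indices). Nothing is assumed on the
  remaining components of the curvature, in particular on \<open>R\<^sup>a\<^sub>0\<^sub>c\<^sub>0\<close> and on those which vanish.\<close>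

definition structure_functions ::
  "nat \<Rightarrow> ('m::topological_space, 'e::euclidean_space) chart set \<Rightarrow> 'm connection \<Rightarrow> 'm set \<Rightarrow>
   (nat \<Rightarrow> 'm cvfield) \<Rightarrow>
   (nat \<Rightarrow> nat \<Rightarrow> nat \<Rightarrow> 'm \<Rightarrow> complex) \<Rightarrow>
   (nat \<Rightarrow> nat \<Rightarrow> nat \<Rightarrow> nat \<Rightarrow> 'm \<Rightarrow> complex) \<Rightarrow>
   (nat \<Rightarrow> nat \<Rightarrow> nat \<Rightarrow> nat \<Rightarrow> 'm \<Rightarrow> complex) \<Rightarrow>
   (nat \<Rightarrow> nat \<Rightarrow> nat \<Rightarrow> nat \<Rightarrow> 'm \<Rightarrow> complex) \<Rightarrow>
   (nat \<Rightarrow> nat \<Rightarrow> nat \<Rightarrow> nat \<Rightarrow> 'm \<Rightarrow> complex) \<Rightarrow> bool" where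
  "structure_functions n A D U \<epsilon> Bs As At Bt Bu \<longleftrightarrow>
     first_structure_eqs n A U \<epsilon> Bs \<and>
     (\<forall>p\<in>U. \<forall>a\<in>{1..n}. \<forall>b\<in>{1..n}. \<forall>c\<in>{1..n}. \<forall>d\<in>{1..n}.
        Bs a b c p = - Bs b a c p \<and>
        As a b c d p = - As a b d c p \<and>
        R_up n A D \<epsilon> p a (hat n b) c d =
          2 * (alt2 (\<lambda>c d. Bt a b c d p) c d - alt2 (\<lambda>c d. kd a c * kd b d) c d) \<and>
        R_up n A D \<epsilon> p a (hat n b) c (hat n d) =
          Bu a b d c p - (\<Sum>h=1..n. Bs a b h p * Bs h d c p) \<and>
        R_up n A D \<epsilon> p a b c d = 2 * As a b c d p \<and>
        R_up n A D \<epsilon> p a b c (hat n d) =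
          At a d b c p - (\<Sum>h=1..n. Bs a h c p * cnj (Bs b h d p)) - kd a c * kd d b)"


section \<open>Index patterns reachable from the listed components\<close>

text \<open>The quadruples of indices for which the component of a real tensor with the algebraic
  symmetries of a curvature tensor is obtained from the components with index patterns
  \<open>a0b0\<close>, \<open>(hat a)0b0\<close>, \<open>(hat a)bcd\<close>, \<open>(hat a)bc(hat d)\<close>,
  \<open>(hat a)(hat b)cd\<close> by these symmetries, the first Bianchi identity
  and conjugation.\<close>

inductive_set reachable :: "nat \<Rightarrow> (nat \<times> nat \<times> nat \<times> nat) set" for n :: nat where
  base1: "a \<in> {1..n} \<Longrightarrow> b \<in> {1..n} \<Longrightarrow> (a, 0, b, 0) \<in> reachable n"
| base2: "a \<in> {1..n} \<Longrightarrow> b \<in> {1..n} \<Longrightarrow> (hat n a, 0, b, 0) \<in> reachable n"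
| base3: "a \<in> {1..n} \<Longrightarrow> b \<in> {1..n} \<Longrightarrow> c \<in> {1..n} \<Longrightarrow> d \<in> {1..n} \<Longrightarrow>
    (hat n a, b, c, d) \<in> reachable n"
| base4: "a \<in> {1..n} \<Longrightarrow> b \<in> {1..n} \<Longrightarrow> c \<in> {1..n} \<Longrightarrow> d \<in> {1..n} \<Longrightarrow>
    (hat n a, b, c, hat n d) \<in> reachable n"
| base5: "a \<in> {1..n} \<Longrightarrow> b \<in> {1..n} \<Longrightarrow> c \<in> {1..n} \<Longrightarrow> d \<in> {1..n} \<Longrightarrow>
    (hat n a, hat n b, c, d) \<in> reachable n"
| skew1: "(i, j, k, l) \<in> reachable n \<Longrightarrow> (j, i, k, l) \<in> reachable n"
| skew2: "(i, j, k, l) \<in> reachable n \<Longrightarrow> (i, j, l, k) \<in> reachable n"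
| pair: "(i, j, k, l) \<in> reachable n \<Longrightarrow> (k, l, i, j) \<in> reachable n"
| bianchi: "(i, k, l, j) \<in> reachable n \<Longrightarrow> (i, l, j, k) \<in> reachable n \<Longrightarrow>
    (i, j, k, l) \<in> reachable n"
| conj: "(i, j, k, l) \<in> reachable n \<Longrightarrow> (hat n i, hat n j, hat n k, hat n l) \<in> reachable n"

end

(* On a manifold of Kenmotsu type the identity at Y = xi gives nabla_X xi = X - eta(X) xi, hence
   R(X,Y) xi = eta(X) Y - eta(Y) X; this determines every component of R with an index 0. On the
   i-eigenbundle of Phi the identity says that nabla preserves this bundle. The bundle is isotropic,
   so the components R_abcd without hatted indices vanish. With the symmetries of R, the components
   of B follow by contraction and by the defining relations of the structure functions.
   The Kenmotsu identity is assumed for global fields but needed for the local fields of a frame: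
   it is transported by a bump function equal to 1 at the given point. *)

theory Submission
  imports Defs
begin

section \<open>Smooth functions on Euclidean spaces\<close>

text \<open>The eigenbundle is preserved only along itself. If Phi X = i X and Phi Y = i Y, then
  eta(Y) = 0 and the second term of the identity is i * i = -1 times the first, so that 2 (nabla_X
  Phi) Y = 0. As the torsion is zero, the bundle is then closed under brackets, and R(X,Y)Z stays in
  it for X, Y, Z in it. The obstacle is locality. A local field is a function on the whole manifold
  with arbitrary values outside \<open>U\<close>, and the connection receives the whole function.
  That D X Y on \<open>U\<close> depends only on values on \<open>U\<close> is extracted from
  linearity over functions smooth on \<open>U\<close>, whose values outside \<open>U\<close> are
  free. The symmetries of the complex curvature are reduced to the real ones by expansion into real
  and imaginary parts, at the level of fields; at a fixed point only the algebra of a finite array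
  of numbers remains. The term 2 n a1 in component 2 comes from r_00 = -2n; the -a0 next to 2 a2 s
  in components 4 and 5 comes from the deltas in the relation between structure functions and
  curvature.\<close>

lemma Ck_on_cong:
  assumes "open S" "\<And>x. x \<in> S \<Longrightarrow> f x = g x" "Ck_on k f S"
  shows "Ck_on k g S"
  using assms(2,3)
proof (induction k arbitrary: f g)
  case 0
  then show ?case
    using continuous_on_cong[of S S f g] by simp
next
  case (Suc k)
  have d: "(g has_derivative frechet_derivative f (at x)) (at x)" if "x \<in> S" for x
  proof (rule has_derivative_transform_within_open[OF _ \<open>open S\<close> that Suc.prems(1)])
    show "(f has_derivative frechet_derivative f (at x)) (at x)"
      using Suc.prems(2) that unfolding Ck_on.simps(2) frechet_derivative_works by blast
  qed
  have "frechet_derivative f (at x) v = frechet_derivative g (at x) v" if "x \<in> S" for x v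
    using frechet_derivative_at[OF d[OF that]] by (rule fun_cong)
  moreover have "Ck_on k (\<lambda>x. frechet_derivative f (at x) v) S" for v
    using Suc.prems(2) unfolding Ck_on.simps(2) by blast
  ultimately have "Ck_on k (\<lambda>x. frechet_derivative g (at x) v) S" for v
    by (rule Suc.IH)
  then show ?case
    using d unfolding Ck_on.simps(2) differentiable_def by blast
qed

text \<open>Replaces the chosen \<open>frechet_derivative\<close> by an explicit derivative; the
  closure rules below obtain one from the calculus of \<open>has_derivative\<close>.\<close>

lemma Ck_on_SucI:
  assumes "open S" "\<And>x. x \<in> S \<Longrightarrow> (f has_derivative f' x) (at x)"
    and "\<And>v. Ck_on k (\<lambda>x. f' x v) S"
  shows "Ck_on (Suc k) f S"
proof -
  have "f' x v = frechet_derivative f (at x) v" if "x \<in> S" for x v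
    using frechet_derivative_at[OF assms(2)[OF that]] by (rule fun_cong)
  then have "Ck_on k (\<lambda>x. frechet_derivative f (at x) v) S" for v
    by (rule Ck_on_cong[OF \<open>open S\<close> _ assms(3)])
  then show ?thesis
    using assms(2) unfolding Ck_on.simps(2) differentiable_def by blast
qed

lemma Ck_on_Suc_has_derivative:
  "Ck_on (Suc k) f S \<Longrightarrow> x \<in> S \<Longrightarrow> (f has_derivative frechet_derivative f (at x)) (at x)"
  unfolding Ck_on.simps(2) frechet_derivative_works by blast

lemma Ck_on_Suc_frechet_derivative:
  "Ck_on (Suc k) f S \<Longrightarrow> Ck_on k (\<lambda>x. frechet_derivative f (at x) v) S"
  unfolding Ck_on.simps(2) by blast

lemma Ck_on_subset: "Ck_on k f T \<Longrightarrow> S \<subseteq> T \<Longrightarrow> Ck_on k f S"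
  by (induction k arbitrary: f) (auto intro: continuous_on_subset)

text \<open>The product rule needs this: the derivative of a product contains the factors
  themselves, which must be available one order lower.\<close>

lemma Ck_on_SucD: "Ck_on (Suc k) f S \<Longrightarrow> Ck_on k f S"
proof (induction k arbitrary: f)
  case 0
  then show ?case
    by (auto intro!: continuous_at_imp_continuous_on differentiable_imp_continuous_within)
next
  case (Suc k)
  have "\<forall>x\<in>S. f differentiable (at x)" "Ck_on (Suc k) (\<lambda>x. frechet_derivative f (at x) v) S" for v
    using Suc.prems by (subst (asm) Ck_on.simps(2), blast)+
  then show ?case
    using Suc.IH by (subst Ck_on.simps(2)) blast
qed

lemma Ck_on_const: "Ck_on k (\<lambda>x. c) S"
  by (induction k arbitrary: c) auto

section \<open>Closure of \<open>Ck_on\<close> under sums, products and gluing\<close>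

lemma Ck_on_add:
  assumes "open S" "Ck_on k f S" "Ck_on k g S"
  shows "Ck_on k (\<lambda>x. f x + g x) S"
  using assms(2,3)
proof (induction k arbitrary: f g)
  case 0
  then show ?case by (simp add: continuous_on_add)
next
  case (Suc k)
  show ?case
  proof (rule Ck_on_SucI[OF \<open>open S\<close>])
    show "((\<lambda>x. f x + g x) has_derivative
        (\<lambda>v. frechet_derivative f (at x) v + frechet_derivative g (at x) v)) (at x)" if "x \<in>
            S" for x
      using Suc.prems that by (intro has_derivative_add Ck_on_Suc_has_derivative)
  qed (intro Suc.IH Suc.prems[THEN Ck_on_Suc_frechet_derivative])
qed

lemma Ck_on_mult:
  fixes f g :: "'a::euclidean_space \<Rightarrow> real"
  assumes "open S" "Ck_on k f S" "Ck_on k g S"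
  shows "Ck_on k (\<lambda>x. f x * g x) S"
  using assms(2,3)
proof (induction k arbitrary: f g)
  case 0
  then show ?case by (simp add: continuous_on_mult)
next
  case (Suc k)
  show ?case
  proof (rule Ck_on_SucI[OF \<open>open S\<close>])
    show "((\<lambda>x. f x * g x) has_derivative
        (\<lambda>v. f x * frechet_derivative g (at x) v + frechet_derivative f (at x) v * g x)) (at x)"
      if "x \<in> S" for x
      using Suc.prems that by (intro has_derivative_mult Ck_on_Suc_has_derivative)
  qed (intro Ck_on_add[OF \<open>open S\<close>] Suc.IH Suc.prems[THEN Ck_on_Suc_frechet_derivative]
      Suc.prems[THEN Ck_on_SucD])
qed

lemma Ck_on_inner:
  assumes "open S" "Ck_on k f S"
  shows "Ck_on k (\<lambda>x. f x \<bullet> b) S"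
  using assms(2)
proof (induction k arbitrary: f)
  case 0
  then show ?case by (simp add: continuous_on_inner)
next
  case (Suc k)
  show ?case
  proof (rule Ck_on_SucI[OF \<open>open S\<close>])
    show "((\<lambda>x. f x \<bullet> b) has_derivative (\<lambda>v. frechet_derivative f (at x) v \<bullet> b)) (at x)"
      if "x \<in> S" for x
      using Suc.prems that by (intro has_derivative_inner_left Ck_on_Suc_has_derivative)
  qed (intro Suc.IH Suc.prems[THEN Ck_on_Suc_frechet_derivative])
qed

text \<open>Differentiability is pointwise, so openness of the sets enters only through continuity
  at order 0.\<close>

lemma Ck_on_Union:
  assumes "\<And>T. T \<in> \<T> \<Longrightarrow> open T" "\<And>T. T \<in> \<T> \<Longrightarrow> Ck_on k f T"
  shows "Ck_on k f (\<Union>\<T>)"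
  using assms(2)
proof (induction k arbitrary: f)
  case 0
  then show ?case using assms(1) continuous_on_open_Union[of \<T> f] by auto
qed auto

lemma Ck_on_Un: "open S \<Longrightarrow> open T \<Longrightarrow> Ck_on k f S \<Longrightarrow> Ck_on k f T \<Longrightarrow> Ck_on k f (S \<union> T)"
  using Ck_on_Union[of "{S, T}" k f] by auto

lemma Ck_on_sum:
  assumes "open S" "\<And>i. i \<in> I \<Longrightarrow> Ck_on k (f i) S"
  shows "Ck_on k (\<lambda>x. \<Sum>i\<in>I. f i x) S"
  using assms(2)
proof (induction I rule: infinite_finite_induct)
  case (insert i I)
  have "Ck_on k (\<lambda>x. f i x + (\<Sum>i\<in>I. f i x)) S"
    using insert by (intro Ck_on_add[OF \<open>open S\<close>]) auto
  then show ?case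
    using insert.hyps by simp
qed (simp_all add: Ck_on_const)

section \<open>The flat functions exp(-1/t) / t^j\<close>

text \<open>The family is closed under derivatives, so that all its members are smooth at once.\<close>

definition flat :: "nat \<Rightarrow> real \<Rightarrow> real" where
  "flat j t = (if t \<le> 0 then 0 else inverse t ^ j * exp (- inverse t))"

text \<open>Substituting the inverse turns the limit from the right at 0 into the decay of
  \<open>x ^ j * exp (- x)\<close> at infinity.\<close>

lemma flat_tendsto_0: "(flat j \<longlongrightarrow> 0) (at 0)"
proof -
  have "((\<lambda>x::real. x ^ j * exp (- x)) \<longlongrightarrow> 0) at_top"
    using tendsto_power_div_exp_0[of j] by (simp add: exp_minus divide_inverse)
  then have "((\<lambda>t. inverse t ^ j * exp (- inverse t)) \<longlongrightarrow> (0::real)) (at_right 0)"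
    by (rule filterlim_compose[OF _ filterlim_inverse_at_top_right])
  then have "(flat j \<longlongrightarrow> 0) (at_right 0)"
    by (rule Lim_transform_eventually)
      (auto simp: flat_def eventually_at_filter intro!: always_eventually)
  moreover have "(flat j \<longlongrightarrow> 0) (at_left 0)"
    by (rule Lim_transform_eventually[OF tendsto_const])
      (auto simp: flat_def eventually_at_filter intro!: always_eventually)
  ultimately show ?thesis
    by (simp add: filterlim_split_at)
qed

text \<open>For t > 0 the exponential contributes a factor \<open>inverse t ^ 2\<close>, a shift of
  the index by two, and the power contributes a shift by one with coefficient -j.\<close>

lemma flat_has_derivative:
  "(flat j has_real_derivative flat (Suc (Suc j)) t - real j * flat (Suc j) t) (at t)"
proof -
  consider "t < 0" | "t = 0" | "t > 0" by linarith
  then show ?thesis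
  proof cases
    case 1
    have "(flat j has_real_derivative 0) (at t)"
    proof (rule has_field_derivative_transform_within_open)
      show "((\<lambda>t. 0) has_real_derivative 0) (at t)" by simp
    qed (use 1 in \<open>auto simp: flat_def intro: open_lessThan[of 0]\<close>)
    then show ?thesis
      using 1 by (simp add: flat_def)
  next
    \<comment> \<open>At 0 the difference quotient of \<open>flat j\<close> is
      \<open>flat (Suc j)\<close>, so differentiability there is the limit of another member of the
      family.\<close>
    case 2
    have "((\<lambda>h. flat j h / h) \<longlongrightarrow> 0) (at 0)"
    proof (rule Lim_transform_eventually[OF flat_tendsto_0[of "Suc j"]])
      show "\<forall>\<^sub>F x in at 0. flat (Suc j) x = flat j x / x"
        by (rule always_eventually) (simp add: flat_def field_simps)
    qed
    then show ?thesis
      using 2 by (simp add: has_field_derivative_iff flat_def)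
  next
    case 3
    have inv: "(inverse has_real_derivative - (inverse t ^ 2)) (at t)"
      using DERIV_inverse[of t] 3 by (simp add: numeral_2_eq_2)
    have "((\<lambda>t. inverse t ^ j * exp (- inverse t)) has_real_derivative
        (real j * (- (inverse t ^ 2)) * inverse t ^ (j - 1)) * exp (- inverse t)
          + (exp (- inverse t) * inverse t ^ 2) * inverse t ^ j) (at t)"
      by (rule derivative_eq_intros inv refl | simp)+
    then have "(flat j has_real_derivative
        (real j * (- (inverse t ^ 2)) * inverse t ^ (j - 1)) * exp (- inverse t)
          + (exp (- inverse t) * inverse t ^ 2) * inverse t ^ j) (at t)"
    proof (rule has_field_derivative_transform_within_open)
      show "open {0::real<..}" "t \<in> {0<..}" using 3 by auto
    qed (auto simp: flat_def)
    moreover have "(real j * (- (inverse t ^ 2)) * inverse t ^ (j - 1)) * exp (- inverse t)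
          + (exp (- inverse t) * inverse t ^ 2) * inverse t ^ j
        = flat (Suc (Suc j)) t - real j * flat (Suc j) t"
      \<comment> \<open>The power rule leaves the truncated exponent \<open>j - 1\<close>; for j = 0
        the factor \<open>real j\<close> removes that term.\<close>
      using 3 by (cases j) (simp_all add: flat_def power2_eq_square algebra_simps)
    ultimately show ?thesis by simp
  qed
qed

lemma Ck_on_flat_compose:
  fixes u :: "'a::euclidean_space \<Rightarrow> real"
  assumes "open S" "\<And>k. Ck_on k u S"
  shows "Ck_on k (\<lambda>x. flat j (u x)) S"
proof (induction k arbitrary: j)
  case 0
  have "continuous_on UNIV (flat j)"
    using flat_has_derivative DERIV_isCont continuous_at_imp_continuous_on by blast
  moreover have "continuous_on S u" using assms(2)[of 0] by simp
  ultimately show ?case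
    by (simp add: continuous_on_compose2)
next
  case (Suc k)
  show ?case
  proof (rule Ck_on_SucI[OF \<open>open S\<close>])
    show "((\<lambda>x. flat j (u x)) has_derivative
        (\<lambda>v. (flat (Suc (Suc j)) (u x) + (- real j) * flat (Suc j) (u x))
          * frechet_derivative u (at x) v)) (at x)" if "x \<in> S" for x
      using has_derivative_compose[OF Ck_on_Suc_has_derivative[OF assms(2) that]
          flat_has_derivative[unfolded has_field_derivative_def]] by simp
  qed (intro Ck_on_mult Ck_on_add Suc.IH Ck_on_const \<open>open S\<close>
      Ck_on_Suc_frechet_derivative[OF assms(2)])
qed

section \<open>Smooth functions and vector fields on manifolds\<close>

locale smooth_manifold =
  fixes A :: "('m::{t2_space, second_countable_topology}, 'e::euclidean_space) chart set"
  assumes atlas: "smooth_atlas A"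
begin

section \<open>Charts and smooth functions on open sets\<close>

lemma chart_homeomorphism:
  assumes "c \<in> A"
  shows "homeomorphism (fst c) (snd c ` fst c) (snd c) (chart_inv c)"
    and "open (fst c)" and "open (snd c ` fst c)"
  using assms atlas unfolding smooth_atlas_def is_chart_def by blast+

lemma chart_inv_chart: "c \<in> A \<Longrightarrow> q \<in> fst c \<Longrightarrow> chart_inv c (snd c q) = q"
  using chart_homeomorphism(1)[of c] by (simp add: homeomorphism_def)

lemma open_chart_image:
  assumes "c \<in> A" "open U"
  shows "open (snd c ` (U \<inter> fst c))"
proof -
  have "openin (top_of_set (fst c)) (U \<inter> fst c)"
    using assms(2) by (auto simp: openin_open)
  from homeomorphism_imp_open_map[OF chart_homeomorphism(1)[OF assms(1)] this]
  show ?thesis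
    using chart_homeomorphism(3)[OF assms(1)] openin_open_trans by blast
qed

lemma smooth_fun_iff:
  "smooth_fun A U f \<longleftrightarrow> (\<forall>c\<in>A. \<forall>k. Ck_on k (\<lambda>x. f (chart_inv c x)) (snd c ` (U \<inter> fst c)))"
  by (simp add: smooth_fun_def smooth_on_def comp_def)

lemma smooth_fun_cong:
  assumes "open U" "\<And>p. p \<in> U \<Longrightarrow> f p = h p" "smooth_fun A U f"
  shows "smooth_fun A U h"
  unfolding smooth_fun_iff
proof (intro ballI allI)
  fix c k assume c: "c \<in> A"
  show "Ck_on k (\<lambda>x. h (chart_inv c x)) (snd c ` (U \<inter> fst c))"
  proof (rule Ck_on_cong[OF open_chart_image[OF c assms(1)]])
    show "Ck_on k (\<lambda>x. f (chart_inv c x)) (snd c ` (U \<inter> fst c))"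
      using assms(3) c by (simp add: smooth_fun_iff)
  qed (use assms(2) c in \<open>auto simp: chart_inv_chart\<close>)
qed

lemma smooth_fun_subset: "smooth_fun A U f \<Longrightarrow> V \<subseteq> U \<Longrightarrow> smooth_fun A V f"
  unfolding smooth_fun_iff by (meson Ck_on_subset Int_mono image_mono order_refl)

lemma smooth_fun_Un:
  assumes "open U" "open V" "smooth_fun A U f" "smooth_fun A V f"
  shows "smooth_fun A (U \<union> V) f"
  using assms by (auto simp: smooth_fun_iff Int_Un_distrib2 image_Un intro!: Ck_on_Un
      open_chart_image)

lemma smooth_fun_const: "smooth_fun A U (\<lambda>p. c)"
  by (simp add: smooth_fun_iff Ck_on_const)

lemma smooth_fun_add:
  "open U \<Longrightarrow> smooth_fun A U f \<Longrightarrow> smooth_fun A U h \<Longrightarrow> smooth_fun A U (\<lambda>p. f p + h p)"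
  by (simp add: smooth_fun_iff Ck_on_add open_chart_image)

lemma smooth_fun_mult:
  "open U \<Longrightarrow> smooth_fun A U f \<Longrightarrow> smooth_fun A U h \<Longrightarrow> smooth_fun A U (\<lambda>p. f p * h p)"
  by (simp add: smooth_fun_iff Ck_on_mult open_chart_image)

lemma smooth_nearI: "smooth_fun A U f \<Longrightarrow> open U \<Longrightarrow> p \<in> U \<Longrightarrow> smooth_near A p f"
  unfolding smooth_near_def by blast

lemma smooth_near2:
  assumes "smooth_near A p f" "smooth_near A p h"
  obtains U where "open U" "p \<in> U" "smooth_fun A U f" "smooth_fun A U h"
proof -
  from assms obtain U V where "open U" "p \<in> U" "smooth_fun A U f" "open V" "p \<in> V"
      "smooth_fun A V h"
    unfolding smooth_near_def by blast
  then show thesis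
    using smooth_fun_subset[of _ _ "U \<inter> V"] by (intro that[of "U \<inter> V"]) auto
qed

lemma smooth_near_mult: "smooth_near A p f \<Longrightarrow> smooth_near A p h \<Longrightarrow> smooth_near A p (\<lambda>q. f q * h q)"
  by (erule (1) smooth_near2) (auto intro: smooth_nearI smooth_fun_mult)

lemma smooth_near_const: "smooth_near A p (\<lambda>q. c)"
  using smooth_nearI[OF smooth_fun_const open_UNIV UNIV_I] .

lemma smooth_near_cmult: "smooth_near A p f \<Longrightarrow> smooth_near A p (\<lambda>q. c * f q)"
  by (intro smooth_near_mult smooth_near_const)

section \<open>Tangent vectors as derivations of germs\<close>

context
  fixes p :: 'm and v :: "'m tvec"
  assumes v: "v \<in> tangent A p"
begin

lemma tangent_add: "smooth_near A p f \<Longrightarrow> smooth_near A p h \<Longrightarrow> v (\<lambda>q. f q + h q) = v f + v h"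
  using v unfolding tangent_def by blast

lemma tangent_mult:
  "smooth_near A p f \<Longrightarrow> smooth_near A p h \<Longrightarrow> v (\<lambda>q. f q * h q) = f p * v h + h p * v f"
  using v unfolding tangent_def by blast

lemma tangent_cmult: "smooth_near A p f \<Longrightarrow> v (\<lambda>q. c * f q) = c * v f"
  using v unfolding tangent_def by blast

lemma tangent_cong: "smooth_near A p f \<Longrightarrow> \<forall>\<^sub>F q in nhds p. f q = h q \<Longrightarrow> v f = v h"
  using v unfolding tangent_def by blast

lemma tangent_not_smooth: "\<not> smooth_near A p f \<Longrightarrow> v f = 0"
  using v unfolding tangent_def by blast

lemma tangent_const: "v (\<lambda>q. c) = 0"
proof -
  have "v (\<lambda>q. 1) = 0"
    using tangent_mult[OF smooth_near_const smooth_near_const, of 1 1] by simp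
  then show ?thesis
    using tangent_cmult[OF smooth_near_const, of c 1] by simp
qed

lemma tangent_diff:
  assumes "smooth_near A p f" "smooth_near A p h"
  shows "v (\<lambda>q. f q - h q) = v f - v h"
  using tangent_add[OF assms(1) smooth_near_cmult[OF assms(2), of "-1"]]
    tangent_cmult[OF assms(2), of "-1"] by simp

end

lemma tangentI:
  assumes "\<And>f h. smooth_near A p f \<Longrightarrow> smooth_near A p h \<Longrightarrow> v (\<lambda>q. f q + h q) = v f + v h"
    and "\<And>f h. smooth_near A p f \<Longrightarrow> smooth_near A p h \<Longrightarrow>
      v (\<lambda>q. f q * h q) = f p * v h + h p * v f"
    and "\<And>f c. smooth_near A p f \<Longrightarrow> v (\<lambda>q. c * f q) = c * v f"
    and "\<And>f h. smooth_near A p f \<Longrightarrow> \<forall>\<^sub>F q in nhds p. f q = h q \<Longrightarrow> v f = v h"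
    and "\<And>f. \<not> smooth_near A p f \<Longrightarrow> v f = 0"
  shows "v \<in> tangent A p"
  using assms unfolding tangent_def by blast

lemma tangent_zero: "(\<lambda>f. 0) \<in> tangent A p"
  by (rule tangentI) simp_all

lemma tangent_plus:
  assumes "x \<in> tangent A p" "y \<in> tangent A p"
  shows "(\<lambda>f. x f + y f) \<in> tangent A p"
proof (rule tangentI)
  fix f h assume "smooth_near A p f" "\<forall>\<^sub>F q in nhds p. f q = h q"
  then show "x f + y f = x h + y h"
    using tangent_cong[OF assms(1)] tangent_cong[OF assms(2)] by metis
qed (simp_all add: assms[THEN tangent_add] assms[THEN tangent_mult] assms[THEN tangent_cmult]
    assms[THEN tangent_not_smooth] algebra_simps)

lemma tangent_scale:
  assumes "x \<in> tangent A p"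
  shows "(\<lambda>f. c * x f) \<in> tangent A p"
proof (rule tangentI)
  fix f h assume "smooth_near A p f" "\<forall>\<^sub>F q in nhds p. f q = h q"
  then show "c * x f = c * x h"
    using tangent_cong[OF assms(1)] by metis
qed (simp_all add: tangent_add[OF assms] tangent_mult[OF assms] tangent_cmult[OF assms]
    tangent_not_smooth[OF assms] algebra_simps)

lemma tangent_minus: "x \<in> tangent A p \<Longrightarrow> y \<in> tangent A p \<Longrightarrow> (\<lambda>f. x f - y f) \<in> tangent A p"
  using tangent_plus[OF _ tangent_scale[of y p "-1"], of x] by simp

lemma tangent_uminus: "x \<in> tangent A p \<Longrightarrow> (\<lambda>f. - x f) \<in> tangent A p"
  using tangent_scale[of x p "-1"] by simp

section \<open>Vector fields over an open set\<close>

lemma vfield_on_tangent: "vfield_on A U X \<Longrightarrow> p \<in> U \<Longrightarrow> X p \<in> tangent A p"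
  unfolding vfield_on_def by blast

lemma vfield_on_smooth: "vfield_on A U X \<Longrightarrow> open U \<Longrightarrow> smooth_fun A U f \<Longrightarrow> smooth_fun A U (\<lambda>p. X p f)"
  unfolding vfield_on_def by blast

lemma vfield_on_subset: "vfield_on A U X \<Longrightarrow> V \<subseteq> U \<Longrightarrow> vfield_on A V X"
  unfolding vfield_on_def by (meson order_trans subsetD)

lemma vfield_on_smooth_near:
  assumes "vfield_on A U X" "open U" "p \<in> U" "smooth_near A p f"
  shows "smooth_near A p (\<lambda>q. X q f)"
proof -
  obtain V where V: "open V" "p \<in> V" "smooth_fun A V f"
    using assms(4) unfolding smooth_near_def by blast
  have "smooth_fun A (U \<inter> V) (\<lambda>q. X q f)"
    by (rule vfield_on_smooth[OF vfield_on_subset[OF assms(1)]])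
      (use assms(2) V smooth_fun_subset[OF V(3)] in auto)
  then show ?thesis
    by (rule smooth_nearI) (use assms V in auto)
qed

lemma vfield_on_cong:
  assumes "vfield_on A U X" "\<And>p. p \<in> U \<Longrightarrow> X p = Y p"
  shows "vfield_on A U Y"
  unfolding vfield_on_def
proof (intro conjI ballI allI impI)
  fix V f assume V: "open V \<and> V \<subseteq> U \<and> smooth_fun A V f"
  show "smooth_fun A V (\<lambda>p. Y p f)"
    by (rule smooth_fun_cong[where f = "\<lambda>p. X p f"]) (use V assms in \<open>auto simp: vfield_on_def\<close>)
next
  fix p assume "p \<in> U"
  then show "Y p \<in> tangent A p"
    using assms unfolding vfield_on_def by metis
qed

lemma vfield_on_zero: "vfield_on A U (\<lambda>p f. 0)"
  by (simp add: vfield_on_def tangent_zero smooth_fun_const)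

lemma vfield_on_add:
  "vfield_on A U X \<Longrightarrow> vfield_on A U Y \<Longrightarrow> vfield_on A U (\<lambda>p f. X p f + Y p f)"
  unfolding vfield_on_def using tangent_plus smooth_fun_add by meson

lemma vfield_on_scale:
  "vfield_on A U X \<Longrightarrow> smooth_fun A U h \<Longrightarrow> vfield_on A U (\<lambda>p f. h p * X p f)"
  unfolding vfield_on_def using tangent_scale smooth_fun_mult smooth_fun_subset by meson

lemma vfield_on_diff:
  assumes "vfield_on A U X" "vfield_on A U Y"
  shows "vfield_on A U (\<lambda>p f. X p f - Y p f)"
  using vfield_on_add[OF assms(1) vfield_on_scale[OF assms(2) smooth_fun_const[of U "-1"]]] by simp

section \<open>Bump functions and global extension of local fields\<close>

text \<open>A flat function of r^2 - |x - x0|^2 in a chart, extended by zero. The preimage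
  \<open>K\<close> of the closed ball is compact, hence closed because the manifold is Hausdorff;
  this makes the extension smooth across the boundary of the chart domain.\<close>

lemma bump_function:
  assumes "open U" "p \<in> U"
  obtains \<psi> K where "smooth_fun A UNIV \<psi>" "\<psi> p = 1" "closed K" "K \<subseteq> U" "\<And>q. q \<notin> K \<Longrightarrow> \<psi> q = 0"
proof -
  obtain c where c: "c \<in> A" "p \<in> fst c"
    using atlas unfolding smooth_atlas_def by blast
  define x0 where "x0 = snd c p"
  have "open (snd c ` (U \<inter> fst c))" "x0 \<in> snd c ` (U \<inter> fst c)"
    using assms c by (auto simp: x0_def intro: open_chart_image)
  then obtain r where r: "r > 0" "cball x0 r \<subseteq> snd c ` (U \<inter> fst c)"
    using open_contains_cball_eq by metis
  define K where "K = chart_inv c ` cball x0 r"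
  have "cball x0 r \<subseteq> snd c ` fst c" using r(2) by auto
  then have "compact K"
    unfolding K_def using homeomorphism_cont2[OF chart_homeomorphism(1)[OF c(1)]]
    by (intro compact_continuous_image) (auto intro: continuous_on_subset)
  then have K: "closed K" by (rule compact_imp_closed)
  have KU: "K \<subseteq> U \<inter> fst c"
  proof
    fix q assume "q \<in> K"
    then obtain q' where "q' \<in> U \<inter> fst c" "q = chart_inv c (snd c q')"
      using r(2) unfolding K_def by blast
    then show "q \<in> U \<inter> fst c" using chart_inv_chart c(1) by simp
  qed
  \<comment> \<open>Written in coordinates, so that smoothness of \<open>u\<close> composed with a
    transition map follows from the rules for sums and real products.\<close>
  define u where "u y = r\<^sup>2 - (\<Sum>b\<in>Basis. ((y - x0) \<bullet> b)\<^sup>2)" for y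
  have u: "u y = r\<^sup>2 - (dist x0 y)\<^sup>2" for y
  proof -
    have "(dist x0 y)\<^sup>2 = (y - x0) \<bullet> (y - x0)"
      by (simp add: dist_norm norm_minus_commute[of x0] power2_norm_eq_inner)
    also have "\<dots> = (\<Sum>b\<in>Basis. ((y - x0) \<bullet> b)\<^sup>2)"
      by (subst euclidean_inner) (simp add: power2_eq_square)
    finally show ?thesis by (simp add: u_def)
  qed
  \<comment> \<open>At \<open>p\<close> the function \<open>u\<close> takes the value r^2, so the
    constant factor normalises \<psi> to 1 there.\<close>
  define \<psi> where "\<psi> q = (if q \<in> fst c then inverse (flat 0 (r\<^sup>2)) * flat 0 (u (snd c q)) else 0)"
      for q
  have "\<psi> p = 1"
    using c r(1) by (simp add: \<psi>_def u flat_def flip: x0_def)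
  moreover have \<psi>0: "\<psi> q = 0" if "q \<notin> K" for q
  proof (cases "q \<in> fst c")
    case True
    then have "snd c q \<notin> cball x0 r"
      using that chart_inv_chart[OF c(1)] unfolding K_def by (metis image_eqI)
    then have "r\<^sup>2 \<le> (dist x0 (snd c q))\<^sup>2"
      using r(1) by (intro power_mono) auto
    then show ?thesis by (simp add: \<psi>_def u flat_def)
  qed (simp add: \<psi>_def)
  moreover have "smooth_fun A UNIV \<psi>"
  proof -
    \<comment> \<open>The complement of \<open>K\<close> and the chart domain are open and cover the
      manifold. On the first \<psi> is zero; on the second it is read in another chart through the
      transition map \<tau>.\<close>
    have 1: "smooth_fun A (- K) \<psi>"
      using K by (intro smooth_fun_cong[OF _ _ smooth_fun_const[of _ 0]]) (auto simp: \<psi>0)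
    have 2: "smooth_fun A (fst c) \<psi>"
      unfolding smooth_fun_iff
    proof (intro ballI allI)
      fix c' k assume c': "c' \<in> A"
      let ?S = "snd c' ` (fst c \<inter> fst c')"
      have S: "open ?S" using open_chart_image[OF c' chart_homeomorphism(2)[OF c(1)]] .
      define \<tau> where "\<tau> y = snd c (chart_inv c' y)" for y
      have \<tau>: "Ck_on k \<tau> ?S" for k
        using atlas c c' unfolding smooth_atlas_def smooth_on_def \<tau>_def comp_def
        by (auto simp: Int_commute)
      have b: "Ck_on k (\<lambda>y. \<tau> y \<bullet> b + (- (x0 \<bullet> b))) ?S" for k b
        by (intro Ck_on_add Ck_on_inner Ck_on_const S \<tau>)
      have "Ck_on k (\<lambda>y. r\<^sup>2 + (\<Sum>b\<in>Basis. (-1) * ((\<tau> y \<bullet> b + (- (x0 \<bullet> b)))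
          * (\<tau> y \<bullet> b + (- (x0 \<bullet> b)))))) ?S" for k
        by (intro Ck_on_add[OF S] Ck_on_sum Ck_on_mult Ck_on_const S b)
      then have "Ck_on k (\<lambda>y. u (\<tau> y)) ?S" for k
        by (simp add: u_def inner_diff_left power2_eq_square sum_negf)
      then have "Ck_on k (\<lambda>y. inverse (flat 0 (r\<^sup>2)) * flat 0 (u (\<tau> y))) ?S"
        by (intro Ck_on_mult Ck_on_const S Ck_on_flat_compose)
      then show "Ck_on k (\<lambda>x. \<psi> (chart_inv c' x)) ?S"
        by (rule Ck_on_cong[OF S, rotated]) (use c' in \<open>auto simp: \<psi>_def \<tau>_def chart_inv_chart\<close>)
    qed
    have "- K \<union> fst c = UNIV" using KU by blast
    with smooth_fun_Un[OF _ _ 1 2] show ?thesis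
      using K chart_homeomorphism(2)[OF c(1)] by (simp add: open_Compl)
  qed
  ultimately show thesis
    using that K KU by blast
qed

text \<open>A local field times a bump function is a global field; the values of the local field
  outside its domain are junk, which the bump function kills.\<close>

lemma vfield_on_bump:
  assumes "open U" "vfield_on A U X" "smooth_fun A UNIV \<psi>" "closed K" "K \<subseteq> U" "\<And>q. q \<notin> K \<Longrightarrow> \<psi> q = 0"
  shows "vfield_on A UNIV (\<lambda>q f. \<psi> q * X q f)"
  unfolding vfield_on_def
proof (intro conjI ballI allI impI)
  fix q
  show "(\<lambda>f. \<psi> q * X q f) \<in> tangent A q"
  proof (cases "q \<in> K")
    case True
    then show ?thesis using assms(5) by (intro tangent_scale vfield_on_tangent[OF assms(2)]) auto
  qed (simp add: assms(6) tangent_zero)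
next
  fix V f assume V: "open V \<and> V \<subseteq> UNIV \<and> smooth_fun A V f"
  have *: "vfield_on A U (\<lambda>q f. \<psi> q * X q f)"
    using smooth_fun_subset[OF assms(3)] by (intro vfield_on_scale assms(2)) simp
  have "smooth_fun A (V \<inter> U) (\<lambda>p. \<psi> p * X p f)"
    by (rule vfield_on_smooth[OF vfield_on_subset[OF *]])
      (use V assms(1) smooth_fun_subset[of V f "V \<inter> U"] in auto)
  moreover have "smooth_fun A (V - K) (\<lambda>p. \<psi> p * X p f)"
    using V assms(4) by (intro smooth_fun_cong[OF _ _ smooth_fun_const[of _ 0]]) (auto
        simp: assms(6))
  ultimately have "smooth_fun A ((V \<inter> U) \<union> (V - K)) (\<lambda>p. \<psi> p * X p f)"
    using V assms(1,4) by (intro smooth_fun_Un) auto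
  moreover have "(V \<inter> U) \<union> (V - K) = V" using assms(5) by blast
  ultimately show "smooth_fun A V (\<lambda>p. \<psi> p * X p f)" by simp
qed

end

section \<open>The Levi-Civita connection over an open set\<close>

definition rcurv ::
  "('m::topological_space, 'e::euclidean_space) chart set \<Rightarrow> 'm connection \<Rightarrow>
   'm vfield \<Rightarrow> 'm vfield \<Rightarrow> 'm vfield \<Rightarrow> 'm vfield" where
  "rcurv A D X Y Z = (\<lambda>p f. D X (D Y Z) p f - D Y (D X Z) p f - D (lie_bracket A X Y) Z p f)"

locale riemannian_region = smooth_manifold A
  for A :: "('m::{t2_space, second_countable_topology}, 'e::euclidean_space) chart set" +
  fixes g :: "'m metric" and D :: "'m connection" and U :: "'m set"
  assumes metric: "riemannian_metric A g" and lc: "levi_civita A g D" and open_U: "open U"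
begin

abbreviation VF :: "'m vfield \<Rightarrow> bool" where "VF \<equiv> vfield_on A U"

section \<open>Bilinearity of the metric on tangent vectors\<close>

context
  fixes p :: 'm and x z :: "'m tvec"
  assumes x: "x \<in> tangent A p" and z: "z \<in> tangent A p"
begin

lemma g_add_left: "y \<in> tangent A p \<Longrightarrow> g p (\<lambda>f. x f + y f) z = g p x z + g p y z"
  using conjunct1[OF metric[unfolded riemannian_metric_def], THEN spec, THEN bspec, OF x] z by simp

lemma g_scale_left: "g p (\<lambda>f. c * x f) z = c * g p x z"
  using conjunct1[OF metric[unfolded riemannian_metric_def], THEN spec, THEN bspec, OF x] z by simp

lemma g_sym: "g p x z = g p z x"
  using conjunct1[OF metric[unfolded riemannian_metric_def], THEN spec, THEN bspec, OF x] z by simp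

end

lemma g_zero_left: "z \<in> tangent A p \<Longrightarrow> g p (\<lambda>f. 0) z = 0"
  using g_scale_left[of "\<lambda>f. 0" p z 0] tangent_zero by simp

lemma g_uminus_left: "x \<in> tangent A p \<Longrightarrow> z \<in> tangent A p \<Longrightarrow> g p (\<lambda>f. - x f) z = - g p x z"
  using g_scale_left[of x p z "-1"] by simp

lemma g_diff_left:
  assumes "x \<in> tangent A p" "y \<in> tangent A p" "z \<in> tangent A p"
  shows "g p (\<lambda>f. x f - y f) z = g p x z - g p y z"
  using g_add_left[OF assms(1,3) tangent_uminus[OF assms(2)]] g_uminus_left[OF assms(2,3)]
  by simp

lemma g_scale_right: "x \<in> tangent A p \<Longrightarrow> z \<in> tangent A p \<Longrightarrow> g p z (\<lambda>f. c * x f) = c * g p z x"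
  by (simp add: g_sym[of z] g_scale_left tangent_scale)

lemma g_uminus_right: "x \<in> tangent A p \<Longrightarrow> z \<in> tangent A p \<Longrightarrow> g p z (\<lambda>f. - x f) = - g p z x"
  by (simp add: g_sym[of z] g_uminus_left tangent_uminus)

lemma g_diff_right:
  "x \<in> tangent A p \<Longrightarrow> y \<in> tangent A p \<Longrightarrow> z \<in> tangent A p \<Longrightarrow> g p z (\<lambda>f. x f - y f) = g p z x - g p z y"
  by (simp add: g_sym[of z] g_diff_left tangent_minus)

lemma g_zero_right: "z \<in> tangent A p \<Longrightarrow> g p z (\<lambda>f. 0) = 0"
  by (simp add: g_sym[of z] g_zero_left tangent_zero)

lemma g_smooth: "VF X \<Longrightarrow> VF Y \<Longrightarrow> smooth_fun A U (\<lambda>p. g p (X p) (Y p))"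
  using conjunct2[OF conjunct2[OF metric[unfolded riemannian_metric_def]], rule_format, of U X Y]
      open_U
  by simp

lemmas VF_tangent = vfield_on_tangent[where U = U]

section \<open>Module laws and locality of the connection over \<open>U\<close>\<close>

lemma D_VF: "VF X \<Longrightarrow> VF Y \<Longrightarrow> VF (D X Y)"
  using lc[unfolded levi_civita_def, THEN spec, THEN spec, THEN spec, THEN spec, THEN spec,
      of U X Y X "\<lambda>p. 0"] open_U smooth_fun_const[of U 0] by simp

context
  fixes X Y Z :: "'m vfield" and p :: 'm
  assumes X: "VF X" and Y: "VF Y" and Z: "VF Z" and p: "p \<in> U"
begin

lemma D_laws:
  assumes "smooth_fun A U h"
  shows "D (\<lambda>q f. X q f + Y q f) Z p = (\<lambda>f. D X Z p f + D Y Z p f)"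
    and "D X (\<lambda>q f. Y q f + Z q f) p = (\<lambda>f. D X Y p f + D X Z p f)"
    and "D (\<lambda>q f. h q * X q f) Y p = (\<lambda>f. h p * D X Y p f)"
    and "D X (\<lambda>q f. h q * Y q f) p = (\<lambda>f. X p h * Y p f + h p * D X Y p f)"
    and "(\<lambda>f. D X Y p f - D Y X p f) = lie_bracket A X Y p"
    and "X p (\<lambda>q. g q (Y q) (Z q)) = g p (D X Y p) (Z p) + g p (Y p) (D X Z p)"
  using lc[unfolded levi_civita_def, rule_format, of U X Y Z h, THEN conjunct2, THEN bspec, OF _ p]
    open_U X Y Z assms by simp_all

lemma D_add_left: "D (\<lambda>q f. X q f + Y q f) Z p f = D X Z p f + D Y Z p f"
  using D_laws(1)[OF smooth_fun_const] by (rule fun_cong)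

lemma D_add_right: "D X (\<lambda>q f. Y q f + Z q f) p f = D X Y p f + D X Z p f"
  using D_laws(2)[OF smooth_fun_const] by (rule fun_cong)

lemma D_compatible: "X p (\<lambda>q. g q (Y q) (Z q)) = g p (D X Y p) (Z p) + g p (Y p) (D X Z p)"
  using D_laws(6)[OF smooth_fun_const] .

end

context
  fixes X Y :: "'m vfield" and p :: 'm
  assumes X: "VF X" and Y: "VF Y" and p: "p \<in> U"
begin

lemma D_mult_left: "smooth_fun A U h \<Longrightarrow> D (\<lambda>q f. h q * X q f) Y p f = h p * D X Y p f"
  using D_laws(3)[OF X Y X p] by (rule fun_cong)

lemma D_mult_right:
  "smooth_fun A U h \<Longrightarrow> D X (\<lambda>q f. h q * Y q f) p f = X p h * Y p f + h p * D X Y p f"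
  using D_laws(4)[OF X Y X p] by (rule fun_cong)

lemma D_torsion: "lie_bracket A X Y p f = D X Y p f - D Y X p f"
  using fun_cong[OF D_laws(5)[OF X Y X p smooth_fun_const], of f] by simp

lemma D_scale_left: "D (\<lambda>q f. c * X q f) Y p f = c * D X Y p f"
  using D_mult_left[OF smooth_fun_const] .

lemma D_scale_right: "D X (\<lambda>q f. c * Y q f) p f = c * D X Y p f"
  using D_mult_right[OF smooth_fun_const] tangent_const[OF VF_tangent[OF X p]] by simp

lemma D_uminus_left: "D (\<lambda>q f. - X q f) Y p f = - D X Y p f"
  using D_scale_left[of "-1"] by simp

lemma D_uminus_right: "D X (\<lambda>q f. - Y q f) p f = - D X Y p f"
  using D_scale_right[of "-1"] by simp

lemma D_zero_right: "D X (\<lambda>q f. 0) p f = 0"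
  using D_scale_right[of 0] by simp

end

lemma VF_uminus: "VF X \<Longrightarrow> VF (\<lambda>p f. - X p f)"
  using vfield_on_scale[OF _ smooth_fun_const[of U "-1"]] by simp

lemma D_diff_left:
  assumes "VF X" "VF Y" "VF Z" "p \<in> U"
  shows "D (\<lambda>q f. X q f - Y q f) Z p f = D X Z p f - D Y Z p f"
  using D_add_left[OF assms(1) VF_uminus[OF assms(2)] assms(3,4)] D_uminus_left[OF assms(2-4)]
      by simp

lemma D_diff_right:
  assumes "VF X" "VF Y" "VF Z" "p \<in> U"
  shows "D X (\<lambda>q f. Y q f - Z q f) p f = D X Y p f - D X Z p f"
  using D_add_right[OF assms(1,2) VF_uminus[OF assms(3)] assms(4)] D_uminus_right[OF assms(1,3,4)]
      by simp

text \<open>A field vanishing on \<open>U\<close> is its own product with the indicator function of the complement,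
  which is smooth on \<open>U\<close>; so the module laws already give locality.\<close>

lemma vanishing_field:
  assumes "\<And>q. q \<in> U \<Longrightarrow> X q = (\<lambda>f. 0)"
  defines "h \<equiv> \<lambda>q. of_bool (q \<notin> U)"
  shows "(\<lambda>q f. h q * X q f) = X" "smooth_fun A U h"
proof -
  show "(\<lambda>q f. h q * X q f) = X"
    using assms by (auto simp: fun_eq_iff h_def)
  show "smooth_fun A U h"
    by (rule smooth_fun_cong[OF open_U _ smooth_fun_const[of _ 0]]) (simp add: h_def)
qed

text \<open>The difference field equals its multiple by the indicator on the whole manifold;
  linearity over functions pulls out the value 0 at \<open>p\<close>.\<close>

lemma D_cong_left:
  assumes X: "VF X" and Y: "VF Y" and p: "p \<in> U" and eq: "\<And>q. q \<in> U \<Longrightarrow> X q = X' q"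
  shows "D X Y p f = D X' Y p f"
proof -
  have X': "VF X'" using vfield_on_cong[OF X eq] .
  define W where "W = (\<lambda>q f. X q f - X' q f)"
  have W: "VF W" unfolding W_def using X X' by (rule vfield_on_diff)
  have "W q = (\<lambda>f. 0)" if "q \<in> U" for q using eq[OF that] by (simp add: W_def)
  note h = vanishing_field[of W, OF this]
  have "D W Y p f = 0"
    using D_mult_left[OF W Y p h(2), of f] arg_cong[OF h(1), of "\<lambda>W. D W Y p f"] p by simp
  then show ?thesis
    unfolding W_def using D_diff_left[OF X X' Y p] by simp
qed

lemma D_cong_right:
  assumes X: "VF X" and Y: "VF Y" and p: "p \<in> U" and eq: "\<And>q. q \<in> U \<Longrightarrow> Y q = Y' q"
  shows "D X Y p f = D X Y' p f"
proof -
  have Y': "VF Y'" using vfield_on_cong[OF Y eq] .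
  define W where "W = (\<lambda>q f. Y q f - Y' q f)"
  have W: "VF W" unfolding W_def using Y Y' by (rule vfield_on_diff)
  have W0: "W q = (\<lambda>f. 0)" if "q \<in> U" for q using eq[OF that] by (simp add: W_def)
  note h = vanishing_field[of W, OF this]
  \<comment> \<open>In this slot the Leibniz rule adds \<open>X p h * W p f\<close>, which vanishes
    because \<open>W p\<close> does.\<close>
  have "D X W p f = 0"
    using D_mult_right[OF X W p h(2), of f] arg_cong[OF h(1), of "\<lambda>W. D X W p f"] p W0[OF p] by simp
  then show ?thesis
    unfolding W_def using D_diff_right[OF X Y Y' p] by simp
qed

text \<open>Zero torsion writes the bracket on \<open>U\<close> as a difference of covariant
  derivatives, which replaces a check that the commutator is a smooth derivation.\<close>

lemma bracket_VF:
  assumes "VF X" "VF Y" shows "VF (lie_bracket A X Y)"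
  by (rule vfield_on_cong[OF vfield_on_diff[OF D_VF[OF assms] D_VF[OF assms(2,1)]]])
    (simp add: fun_eq_iff D_torsion[OF assms])

lemma bracket_commute: "lie_bracket A X Y = (\<lambda>q f. - lie_bracket A Y X q f)"
  by (simp add: lie_bracket_def fun_eq_iff)

lemma rcurv_VF: "VF X \<Longrightarrow> VF Y \<Longrightarrow> VF Z \<Longrightarrow> VF (rcurv A D X Y Z)"
  unfolding rcurv_def by (intro vfield_on_diff D_VF bracket_VF)

lemma eventually_U: "p \<in> U \<Longrightarrow> (\<And>q. q \<in> U \<Longrightarrow> P q) \<Longrightarrow> eventually P (nhds p)"
  using open_U unfolding eventually_nhds by blast

lemma apply_cong:
  assumes "VF X" "p \<in> U" "smooth_fun A U f" "\<And>q. q \<in> U \<Longrightarrow> f q = h q"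
  shows "X p f = X p h"
  using assms open_U by (intro tangent_cong[OF VF_tangent[OF assms(1,2)]] eventually_U smooth_nearI)

section \<open>Algebraic symmetries of the real curvature\<close>

lemma rcurv_skew:
  assumes "VF X" "VF Y" "VF Z" "p \<in> U"
  shows "rcurv A D X Y Z p f = - rcurv A D Y X Z p f"
  using D_uminus_left[OF bracket_VF[OF assms(2,1)] assms(3,4), of f]
  unfolding rcurv_def bracket_commute[of X Y] by simp

text \<open>The two middle terms are exchanged when X and Y are, so they cancel in the commutator of
  X and Y.\<close>

lemma second_derivative_metric:
  assumes X: "VF X" and Y: "VF Y" and Z: "VF Z" and W: "VF W" and p: "p \<in> U"
  shows "X p (\<lambda>q. Y q (\<lambda>r. g r (Z r) (W r))) =
    g p (D X (D Y Z) p) (W p) + g p (D Y Z p) (D X W p)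
    + g p (D X Z p) (D Y W p) + g p (Z p) (D X (D Y W) p)"
proof -
  note V = D_VF[OF Y Z] D_VF[OF Y W]
  \<comment> \<open>The inner derivative is computed only at points of \<open>U\<close>; this
    suffices since the tangent vector \<open>X p\<close> sees only germs at
    \<open>p\<close>.\<close>
  have "X p (\<lambda>q. Y q (\<lambda>r. g r (Z r) (W r))) = X p (\<lambda>q. g q (D Y Z q) (W q) + g q (Z q) (D Y W q))"
  proof (rule apply_cong[OF X p, symmetric])
    show "smooth_fun A U (\<lambda>q. g q (D Y Z q) (W q) + g q (Z q) (D Y W q))"
      by (intro smooth_fun_add g_smooth V Z W open_U)
  qed (simp add: D_compatible[OF Y Z W])
  also have "\<dots> = X p (\<lambda>q. g q (D Y Z q) (W q)) + X p (\<lambda>q. g q (Z q) (D Y W q))"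
    by (intro tangent_add[OF VF_tangent[OF X p]] smooth_nearI[OF _ open_U p] g_smooth V Z W)
  finally show ?thesis
    using D_compatible[OF X V(1) W p] D_compatible[OF X Z V(2) p] by simp
qed

text \<open>[X,Y] h = X Y h - Y X h is applied to h = g(Z,W), and both sides are expanded by metric
  compatibility.\<close>

lemma rcurv_metric_skew:
  assumes X: "VF X" and Y: "VF Y" and Z: "VF Z" and W: "VF W" and p: "p \<in> U"
  shows "g p (rcurv A D X Y Z p) (W p) = - g p (rcurv A D X Y W p) (Z p)"
proof -
  let ?f = "\<lambda>r. g r (Z r) (W r)"
  note XY = bracket_VF[OF X Y]
  note t = VF_tangent[OF _ p]
  note T = t[OF D_VF[OF X D_VF[OF Y Z]]] t[OF D_VF[OF Y D_VF[OF X Z]]] t[OF D_VF[OF XY Z]]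
    t[OF D_VF[OF X D_VF[OF Y W]]] t[OF D_VF[OF Y D_VF[OF X W]]] t[OF D_VF[OF XY W]]
    t[OF Z] t[OF W] t[OF D_VF[OF X Z]] t[OF D_VF[OF Y Z]] t[OF D_VF[OF X W]] t[OF D_VF[OF Y W]]
  have "smooth_near A p ?f"
    by (intro smooth_nearI[OF _ open_U p] g_smooth Z W)
  then have "lie_bracket A X Y p ?f = X p (\<lambda>q. Y q ?f) - Y p (\<lambda>q. X q ?f)"
    by (simp add: lie_bracket_def)
  then have "g p (D (lie_bracket A X Y) Z p) (W p) + g p (Z p) (D (lie_bracket A X Y) W p)
      = X p (\<lambda>q. Y q ?f) - Y p (\<lambda>q. X q ?f)"
    using D_compatible[OF XY Z W p] by simp
  then show ?thesis
    unfolding second_derivative_metric[OF X Y Z W p] second_derivative_metric[OF Y X Z W p]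
        rcurv_def
    by (simp add: g_diff_left tangent_minus T g_sym[of "Z p"])
qed

lemma jacobi:
  assumes X: "VF X" and Y: "VF Y" and Z: "VF Z" and p: "p \<in> U"
  shows "lie_bracket A X (lie_bracket A Y Z) p f + lie_bracket A Y (lie_bracket A Z X) p f
    + lie_bracket A Z (lie_bracket A X Y) p f = 0"
\<comment> \<open>On functions that are not smooth near \<open>p\<close> every bracket is 0 by
  convention, so only smooth germs need an argument.\<close>
proof (cases "smooth_near A p f")
  case True
  then obtain V where V: "open V" "p \<in> V" "smooth_fun A V f"
    unfolding smooth_near_def by blast
  note sm = vfield_on_smooth_near[OF _ open_U p]
  have *: "lie_bracket A X (lie_bracket A Y Z) p f = X p (\<lambda>q. Y q (\<lambda>r. Z r f))
      - X p (\<lambda>q. Z q (\<lambda>r. Y r f))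
      - (Y p (\<lambda>q. Z q (\<lambda>r. X r f)) - Z p (\<lambda>q. Y q (\<lambda>r. X r f)))"
    if X: "VF X" and Y: "VF Y" and Z: "VF Z" for X Y Z
  proof -
    have "smooth_near A p (\<lambda>q. lie_bracket A Y Z q f)"
      by (intro sm[OF bracket_VF[OF Y Z]] True)
    \<comment> \<open>The case distinction in the bracket is made at each q separately; f is smooth
      near every point of \<open>V\<close>, so the first case applies throughout a neighbourhood of
      \<open>p\<close>.\<close>
    moreover have "\<forall>\<^sub>F q in nhds p. lie_bracket A Y Z q f = Y q (\<lambda>r. Z r f) - Z q (\<lambda>r. Y r f)"
      unfolding eventually_nhds using V smooth_nearI[OF V(3,1)]
      by (intro exI[of _ V]) (auto simp: lie_bracket_def)
    ultimately have "X p (\<lambda>q. lie_bracket A Y Z q f) = X p (\<lambda>q. Y q (\<lambda>r. Z r f) - Z q (\<lambda>r. Y r f))"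
      by (rule tangent_cong[OF VF_tangent[OF X p]])
    also have "\<dots> = X p (\<lambda>q. Y q (\<lambda>r. Z r f)) - X p (\<lambda>q. Z q (\<lambda>r. Y r f))"
      by (intro tangent_diff[OF VF_tangent[OF X p]] sm[OF Y sm[OF Z True]] sm[OF Z sm[OF Y True]])
    finally show ?thesis
      using True sm[OF X True] by (simp add: lie_bracket_def)
  qed
  show ?thesis
    unfolding *[OF X Y Z] *[OF Y Z X] *[OF Z X Y] by simp
qed (simp add: lie_bracket_def)

text \<open>Zero torsion, used twice, leaves a double bracket and a term D_[Y,Z] X for each cyclic
  shift. The latter cancel the bracket terms of the curvature, the former vanish by the Jacobi
  identity.\<close>

lemma rcurv_bianchi:
  assumes X: "VF X" and Y: "VF Y" and Z: "VF Z" and p: "p \<in> U"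
  shows "rcurv A D X Y Z p f + rcurv A D Y Z X p f + rcurv A D Z X Y p f = 0"
proof -
  have *: "D X (D Y Z) p f - D X (D Z Y) p f = lie_bracket A X (lie_bracket A Y Z) p f
      + D (lie_bracket A Y Z) X p f"
    if X: "VF X" and Y: "VF Y" and Z: "VF Z" for X Y Z
  proof -
    have "D X (D Y Z) p f - D X (D Z Y) p f = D X (\<lambda>q f. D Y Z q f - D Z Y q f) p f"
      using D_diff_right[OF X D_VF[OF Y Z] D_VF[OF Z Y] p] by simp
    also have "\<dots> = D X (lie_bracket A Y Z) p f"
      by (rule D_cong_right[OF X vfield_on_diff[OF D_VF[OF Y Z] D_VF[OF Z Y]] p])
        (simp add: fun_eq_iff D_torsion[OF Y Z])
    finally show ?thesis
      using D_torsion[OF X bracket_VF[OF Y Z] p] by simp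
  qed
  show ?thesis
    using *[OF X Y Z] *[OF Y Z X] *[OF Z X Y] jacobi[OF X Y Z p, of f]
    by (simp add: rcurv_def)
qed

definition Rm :: "'m vfield \<Rightarrow> 'm vfield \<Rightarrow> 'm vfield \<Rightarrow> 'm vfield \<Rightarrow> 'm \<Rightarrow> real" where
  "Rm X Y Z W p = g p (rcurv A D X Y Z p) (W p)"

lemma Rm_skew1:
  assumes "VF X" "VF Y" "VF Z" "VF W" "p \<in> U"
  shows "Rm X Y Z W p = - Rm Y X Z W p"
proof -
  have "rcurv A D X Y Z p = (\<lambda>f. - rcurv A D Y X Z p f)"
    using rcurv_skew[OF assms(1-3,5)] by (simp add: fun_eq_iff)
  then show ?thesis
    unfolding Rm_def using assms
    by (simp add: g_uminus_left[OF VF_tangent VF_tangent] rcurv_VF)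
qed

lemma Rm_skew2:
  "VF X \<Longrightarrow> VF Y \<Longrightarrow> VF Z \<Longrightarrow> VF W \<Longrightarrow> p \<in> U \<Longrightarrow> Rm X Y Z W p = - Rm X Y W Z p"
  unfolding Rm_def by (rule rcurv_metric_skew)

lemma Rm_bianchi:
  assumes "VF X" "VF Y" "VF Z" "VF W" "p \<in> U"
  shows "Rm X Y Z W p + Rm Y Z X W p + Rm Z X Y W p = 0"
proof -
  note t = VF_tangent[OF _ assms(5)]
  note T = t[OF rcurv_VF[OF assms(1,2,3)]] t[OF rcurv_VF[OF assms(2,3,1)]]
      t[OF rcurv_VF[OF assms(3,1,2)]]
    t[OF assms(4)]
  have "g p (\<lambda>f. rcurv A D X Y Z p f + rcurv A D Y Z X p f + rcurv A D Z X Y p f) (W p) = 0"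
    unfolding rcurv_bianchi[OF assms(1,2,3,5)] using T(4) by (rule g_zero_left)
  then show ?thesis
    by (simp add: Rm_def g_add_left tangent_plus T)
qed

text \<open>The octahedron argument: the four cyclic Bianchi identities are combined linearly, with
  the skew symmetries matching their terms.\<close>

lemma Rm_pair:
  assumes "VF X" "VF Y" "VF Z" "VF W" "p \<in> U"
  shows "Rm X Y Z W p = Rm Z W X Y p"
  using Rm_bianchi[OF assms(1,2,3,4,5)] Rm_bianchi[OF assms(2,3,4,1,5)]
    Rm_bianchi[OF assms(3,4,1,2,5)] Rm_bianchi[OF assms(4,1,2,3,5)]
    Rm_skew2[OF assms(2,3,1,4,5)] Rm_skew2[OF assms(1,2,3,4,5)] Rm_skew2[OF assms(3,4,2,1,5)]
    Rm_skew2[OF assms(4,1,3,2,5)] Rm_skew2[OF assms(1,3,2,4,5)] Rm_skew2[OF assms(2,4,3,1,5)]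
    Rm_skew1[OF assms(3,1,2,4,5)] Rm_skew1[OF assms(4,2,3,1,5)]
  by linarith

end

section \<open>Local consequences of the Kenmotsu type condition\<close>

locale kenmotsu_region = riemannian_region A g D U
  for A :: "('m::{t2_space, second_countable_topology}, 'e::euclidean_space) chart set"
    and g :: "'m metric" and D :: "'m connection" and U :: "'m set" +
  fixes n :: nat and \<Phi> :: "'m endo" and \<xi> :: "'m vfield"
  assumes acr: "ACR_manifold n A \<Phi> \<xi> g" and kenmotsu: "kenmotsu_type A \<Phi> \<xi> g D"
begin

abbreviation PF :: "'m vfield \<Rightarrow> 'm vfield" where "PF X \<equiv> (\<lambda>q. \<Phi> q (X q))"

section \<open>Pointwise identities of the almost contact structure\<close>

lemma tensor: "tensor_endo A \<Phi>"
  using acr by (simp add: ACR_manifold_def)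

lemma Phi_tangent: "x \<in> tangent A p \<Longrightarrow> \<Phi> p x \<in> tangent A p"
  using conjunct1[OF tensor[unfolded tensor_endo_def], THEN spec, THEN bspec, of x p] by blast

lemma Phi_plus:
  "x \<in> tangent A p \<Longrightarrow> y \<in> tangent A p \<Longrightarrow> \<Phi> p (\<lambda>f. x f + y f) = (\<lambda>f. \<Phi> p x f + \<Phi> p y f)"
  using conjunct1[OF tensor[unfolded tensor_endo_def], THEN spec, THEN bspec, of x p] by simp

lemma Phi_scale: "x \<in> tangent A p \<Longrightarrow> \<Phi> p (\<lambda>f. c * x f) = (\<lambda>f. c * \<Phi> p x f)"
  using conjunct1[OF tensor[unfolded tensor_endo_def], THEN spec, THEN bspec, of x p] by simp

lemma Phi_zero: "\<Phi> p (\<lambda>f. 0) = (\<lambda>f. 0)"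
  using Phi_scale[OF tangent_zero, of p 0] by simp

lemma Phi_uminus: "x \<in> tangent A p \<Longrightarrow> \<Phi> p (\<lambda>f. - x f) = (\<lambda>f. - \<Phi> p x f)"
  using Phi_scale[of x p "-1"] by simp

lemma Phi_minus:
  "x \<in> tangent A p \<Longrightarrow> y \<in> tangent A p \<Longrightarrow> \<Phi> p (\<lambda>f. x f - y f) = (\<lambda>f. \<Phi> p x f - \<Phi> p y f)"
  using Phi_plus[OF _ tangent_uminus[of y], of x p] Phi_uminus[of y p] by simp

lemma Phi_VF: "VF X \<Longrightarrow> VF (PF X)"
  using conjunct2[OF tensor[unfolded tensor_endo_def], rule_format, of U X] open_U by simp

lemma xi_VF: "VF \<xi>"
  using acr vfield_on_subset[of UNIV \<xi> U] by (simp add: ACR_manifold_def)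

lemma xi_tangent: "\<xi> p \<in> tangent A p"
  using acr vfield_on_tangent[of UNIV \<xi> p] by (simp add: ACR_manifold_def)

lemma acr_laws:
  "\<forall>p. \<Phi> p (\<xi> p) = (\<lambda>f. 0) \<and> g p (\<xi> p) (\<xi> p) = 1 \<and>
       (\<forall>x\<in>tangent A p. \<forall>y\<in>tangent A p.
          g p (\<Phi> p x) (\<xi> p) = 0 \<and>
          \<Phi> p (\<Phi> p x) = (\<lambda>f. - x f + g p x (\<xi> p) * \<xi> p f) \<and>
          g p (\<Phi> p x) (\<Phi> p y) = g p x y - g p x (\<xi> p) * g p y (\<xi> p))"
  using acr unfolding ACR_manifold_def by (elim conjE)

lemma Phi_xi: "\<Phi> p (\<xi> p) = (\<lambda>f. 0)" and xi_unit: "g p (\<xi> p) (\<xi> p) = 1"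
  using acr_laws by auto

lemma eta_Phi: "x \<in> tangent A p \<Longrightarrow> g p (\<Phi> p x) (\<xi> p) = 0"
  and Phi_Phi: "x \<in> tangent A p \<Longrightarrow> \<Phi> p (\<Phi> p x) = (\<lambda>f. - x f + g p x (\<xi> p) * \<xi> p f)"
  using acr_laws[rule_format, of p] by auto

lemma g_Phi_Phi:
  "x \<in> tangent A p \<Longrightarrow> y \<in> tangent A p \<Longrightarrow>
    g p (\<Phi> p x) (\<Phi> p y) = g p x y - g p x (\<xi> p) * g p y (\<xi> p)"
  using acr_laws[rule_format, of p] by auto

section \<open>Transport of the Kenmotsu identity to local fields\<close>

text \<open>The equality is needed on the whole manifold, since D is applied to the whole function.
  Outside \<open>U\<close> the values of X are arbitrary, and \<psi> = 0 reduces the claim to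
  \<open>Phi_zero\<close>.\<close>

lemma PF_bump:
  assumes "VF X" "\<And>q. q \<notin> U \<Longrightarrow> \<psi> q = 0"
  shows "PF (\<lambda>q f. \<psi> q * X q f) = (\<lambda>q f. \<psi> q * \<Phi> q (X q) f)"
proof
  fix q show "\<Phi> q (\<lambda>f. \<psi> q * X q f) = (\<lambda>f. \<psi> q * \<Phi> q (X q) f)"
  proof (cases "q \<in> U")
    case True
    then show ?thesis using Phi_scale[OF VF_tangent[OF assms(1)]] by simp
  qed (simp add: assms(2) Phi_zero)
qed

text \<open>The derivative of an endomorphism is tensorial in both fields: the terms with
  \<open>X p \<psi>\<close> cancel between D X (Phi Y) and Phi (D X Y). Hence the value 1 at the
  single point \<open>p\<close> is enough.\<close>

lemma cov_endo_bump:
  assumes X: "VF X" and Y: "VF Y" and p: "p \<in> U"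
    and \<psi>: "smooth_fun A U \<psi>" "\<psi> p = 1" "\<And>q. q \<notin> U \<Longrightarrow> \<psi> q = 0"
  shows "cov_endo D \<Phi> (\<lambda>q f. \<psi> q * X q f) (\<lambda>q f. \<psi> q * Y q f) p f
    = D X (PF Y) p f - \<Phi> p (D X Y p) f"
proof -
  note \<psi>Y = vfield_on_scale[OF Y \<psi>(1)]
  have eq: "PF (\<lambda>q f. \<psi> q * Y q f) = (\<lambda>q f. \<psi> q * \<Phi> q (Y q) f)"
    by (rule PF_bump[OF Y \<psi>(3)])
  have 1: "D (\<lambda>q f. \<psi> q * X q f) (PF (\<lambda>q f. \<psi> q * Y q f)) p f
      = X p \<psi> * \<Phi> p (Y p) f + D X (PF Y) p f"
    unfolding eq
    using D_mult_left[OF X vfield_on_scale[OF Phi_VF[OF Y] \<psi>(1)] p \<psi>(1), of f]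
      D_mult_right[OF X Phi_VF[OF Y] p \<psi>(1), of f] \<psi>(2) by simp
  have "D (\<lambda>q f. \<psi> q * X q f) (\<lambda>q f. \<psi> q * Y q f) p = (\<lambda>f. X p \<psi> * Y p f + D X Y p f)"
    using D_mult_left[OF X \<psi>Y p \<psi>(1)] D_mult_right[OF X Y p \<psi>(1)] \<psi>(2)
    by (simp add: fun_eq_iff)
  then have "\<Phi> p (D (\<lambda>q f. \<psi> q * X q f) (\<lambda>q f. \<psi> q * Y q f) p)
      = (\<lambda>f. X p \<psi> * \<Phi> p (Y p) f + \<Phi> p (D X Y p) f)"
    using Phi_plus[OF tangent_scale VF_tangent[OF D_VF[OF X Y] p]] Phi_scale VF_tangent[OF Y p]
    by simp
  then show ?thesis
    unfolding cov_endo_def 1 by simp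
qed

lemma kenmotsu_local:
  assumes X: "VF X" and Y: "VF Y" and p: "p \<in> U"
  shows "D X (PF Y) p f - \<Phi> p (D X Y p) f - D (PF X) (PF (PF Y)) p f + \<Phi> p (D (PF X) (PF Y) p) f
    = - g p (Y p) (\<xi> p) * \<Phi> p (X p) f"
proof -
  obtain \<psi> K where \<psi>: "smooth_fun A UNIV \<psi>" "\<psi> p = 1" and K: "closed K" "K \<subseteq> U" "\<And>q. q \<notin> K \<Longrightarrow>
      \<psi> q = 0"
    using bump_function[OF open_U p] by metis
  have \<psi>U: "smooth_fun A U \<psi>" "\<psi> p = 1" "\<And>q. q \<notin> U \<Longrightarrow> \<psi> q = 0"
    using \<psi> K smooth_fun_subset[OF \<psi>(1)] by auto
  let ?X = "\<lambda>q f. \<psi> q * X q f" and ?Y = "\<lambda>q f. \<psi> q * Y q f"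
  have eq: "PF (\<lambda>q f. \<psi> q * Z q f) = (\<lambda>q f. \<psi> q * \<Phi> q (Z q) f)" if "VF Z" for Z
    by (rule PF_bump[OF that \<psi>U(3)])
  have "vfield_on A UNIV ?X" "vfield_on A UNIV ?Y"
    using vfield_on_bump[OF open_U X \<psi>(1) K] vfield_on_bump[OF open_U Y \<psi>(1) K] by auto
  then have "(\<lambda>f. cov_endo D \<Phi> ?X ?Y p f - cov_endo D \<Phi> (PF ?X) (PF ?Y) p f)
      = (\<lambda>f. - g p (?Y p) (\<xi> p) * \<Phi> p (?X p) f)"
    using kenmotsu unfolding kenmotsu_type_def by blast
  from fun_cong[OF this, of f]
  have "cov_endo D \<Phi> ?X ?Y p f - cov_endo D \<Phi> (\<lambda>q f. \<psi> q * PF X q f) (\<lambda>q f. \<psi> q * PF Y q f) p f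
      = - g p (Y p) (\<xi> p) * \<Phi> p (X p) f"
    unfolding eq[OF X] eq[OF Y] using \<psi>(2) by simp
  moreover note cov_endo_bump[OF X Y p \<psi>U, of f]
    cov_endo_bump[OF Phi_VF[OF X] Phi_VF[OF Y] p \<psi>U, of f]
  ultimately show ?thesis by linarith
qed

section \<open>Covariant derivative of \<xi> and curvature on \<xi>\<close>

text \<open>At Y = \<xi> only Phi (D X \<xi>) = Phi X is left of the identity. This determines D X
  \<xi> up to a multiple of \<xi>, and that multiple is fixed by differentiating g(\<xi>,\<xi>) =
  1.\<close>

lemma D_xi:
  assumes X: "VF X" and p: "p \<in> U"
  shows "D X \<xi> p f = X p f - g p (X p) (\<xi> p) * \<xi> p f"
proof -
  note DX = VF_tangent[OF D_VF[OF X xi_VF] p]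
  have "D X (PF \<xi>) p f = 0" for f
    unfolding Phi_xi using D_zero_right[OF X xi_VF p] .
  moreover have "D (PF X) (PF (PF \<xi>)) p f = 0" for f
    unfolding Phi_xi Phi_zero using D_zero_right[OF Phi_VF[OF X] xi_VF p] .
  moreover have "D (PF X) (PF \<xi>) p = (\<lambda>f. 0)"
    unfolding Phi_xi using D_zero_right[OF Phi_VF[OF X] xi_VF p] by auto
  ultimately have "\<Phi> p (D X \<xi> p) f = \<Phi> p (X p) f" for f
    using kenmotsu_local[OF X xi_VF p, of f] by (simp add: xi_unit Phi_zero)
  then have "\<Phi> p (D X \<xi> p) = \<Phi> p (X p)" by auto
  then have "\<Phi> p (\<Phi> p (D X \<xi> p)) f = \<Phi> p (\<Phi> p (X p)) f" by simp
  moreover have "g p (D X \<xi> p) (\<xi> p) = 0"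
    using D_compatible[OF X xi_VF xi_VF p] tangent_const[OF VF_tangent[OF X p]]
    by (simp add: xi_unit g_sym[OF xi_tangent DX])
  ultimately show ?thesis
    by (simp add: Phi_Phi[OF DX] Phi_Phi[OF VF_tangent[OF X p]])
qed

text \<open>Arranged for antisymmetrisation: g(X,Y) \<xi> and 2 eta(X) eta(Y) \<xi> are symmetric
  and drop out, and the terms in D X Y cancel against D_[X,Y] \<xi>.\<close>

lemma D_D_xi:
  assumes X: "VF X" and Y: "VF Y" and p: "p \<in> U"
  shows "D X (D Y \<xi>) p f = D X Y p f - (g p (D X Y p) (\<xi> p) + g p (X p) (Y p)) * \<xi> p f
    + 2 * g p (X p) (\<xi> p) * g p (Y p) (\<xi> p) * \<xi> p f - g p (Y p) (\<xi> p) * X p f"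
proof -
  let ?\<eta> = "\<lambda>q. g q (Y q) (\<xi> q)"
  have sm: "smooth_fun A U ?\<eta>" by (rule g_smooth[OF Y xi_VF])
  have "D X (D Y \<xi>) p f = D X (\<lambda>q f. Y q f - ?\<eta> q * \<xi> q f) p f"
    by (rule D_cong_right[OF X D_VF[OF Y xi_VF] p]) (simp add: fun_eq_iff D_xi[OF Y])
  also have "\<dots> = D X Y p f - (X p ?\<eta> * \<xi> p f + ?\<eta> p * D X \<xi> p f)"
    using D_diff_right[OF X Y vfield_on_scale[OF xi_VF sm] p] D_mult_right[OF X xi_VF p sm] by simp
  also have "X p ?\<eta> = g p (D X Y p) (\<xi> p) + g p (Y p) (D X \<xi> p)"
    by (rule D_compatible[OF X Y xi_VF p])
  also have "D X \<xi> p = (\<lambda>f. X p f - g p (X p) (\<xi> p) * \<xi> p f)"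
    using D_xi[OF X p] by auto
  also have "g p (Y p) (\<lambda>f. X p f - g p (X p) (\<xi> p) * \<xi> p f)
      = g p (X p) (Y p) - g p (X p) (\<xi> p) * g p (Y p) (\<xi> p)"
    using VF_tangent[OF X p] VF_tangent[OF Y p] xi_tangent
    by (simp add: g_diff_right g_scale_right tangent_scale g_sym[of "Y p" p "X p"])
  finally show ?thesis
    by (simp add: algebra_simps)
qed

lemma rcurv_xi:
  assumes X: "VF X" and Y: "VF Y" and p: "p \<in> U"
  shows "rcurv A D X Y \<xi> p f = g p (X p) (\<xi> p) * Y p f - g p (Y p) (\<xi> p) * X p f"
proof -
  note t = VF_tangent[OF D_VF[OF X Y] p] VF_tangent[OF D_VF[OF Y X] p]
  have XY: "lie_bracket A X Y p = (\<lambda>f. D X Y p f - D Y X p f)"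
    using D_torsion[OF X Y p] by auto
  show ?thesis
    unfolding rcurv_def D_D_xi[OF X Y p] D_D_xi[OF Y X p] D_xi[OF bracket_VF[OF X Y] p] XY
    by (simp add: g_diff_left t xi_tangent g_sym[OF VF_tangent[OF X p] VF_tangent[OF Y p]]
        algebra_simps)
qed

section \<open>The eigenbundle of Phi for the eigenvalue i\<close>

text \<open>\<open>(x1, x2)\<close> are the real and imaginary parts of a field in the \<open>\<i>\<close>-eigenspace of \<open>\<Phi>\<close>.\<close>

definition type10 :: "'m vfield \<Rightarrow> 'm vfield \<Rightarrow> bool" where
  "type10 x1 x2 \<longleftrightarrow> VF x1 \<and> VF x2 \<and>
     (\<forall>p\<in>U. \<Phi> p (x1 p) = (\<lambda>f. - x2 p f) \<and> \<Phi> p (x2 p) = x1 p)"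

lemma type10_eta:
  assumes "type10 x1 x2" "p \<in> U"
  shows "g p (x1 p) (\<xi> p) = 0" "g p (x2 p) (\<xi> p) = 0"
proof -
  have V: "VF x1" "VF x2" using assms(1) by (auto simp: type10_def)
  show "g p (x1 p) (\<xi> p) = 0"
    using assms eta_Phi[OF VF_tangent[OF V(2) assms(2)]] by (simp add: type10_def)
  show "g p (x2 p) (\<xi> p) = 0"
    using assms eta_Phi[OF VF_tangent[OF V(1) assms(2)]]
    by (simp add: type10_def g_uminus_left[OF VF_tangent[OF V(2) assms(2)] xi_tangent])
qed

text \<open>The resulting pair consists of the real and imaginary parts of nabla_X Y. The identity
  for X = \<open>x1\<close> with Y = \<open>y1\<close> and Y = \<open>y2\<close> gives the two
  eigenvalue equations; its right-hand side vanishes by \<open>type10_eta\<close>.\<close>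

lemma type10_D:
  assumes x: "type10 x1 x2" and y: "type10 y1 y2"
  shows "type10 (\<lambda>p f. D x1 y1 p f - D x2 y2 p f) (\<lambda>p f. D x1 y2 p f + D x2 y1 p f)"
proof -
  have V: "VF x1" "VF x2" "VF y1" "VF y2" using x y by (auto simp: type10_def)
  have xe: "PF x1 q = (\<lambda>f. - x2 q f)" "PF x2 q = x1 q" if "q \<in> U" for q
    using x that by (auto simp: type10_def)
  have ye: "PF y1 q = (\<lambda>f. - y2 q f)" "PF y2 q = y1 q"
    "PF (PF y1) q = (\<lambda>f. - y1 q f)" "PF (PF y2) q = (\<lambda>f. - y2 q f)" if "q \<in> U" for q
    using y that Phi_uminus[OF VF_tangent[OF V(4) that]] by (auto simp: type10_def)
  have eqs: "\<Phi> p (\<lambda>f. D x1 y1 p f - D x2 y2 p f) f = - (D x1 y2 p f + D x2 y1 p f)"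
    "\<Phi> p (\<lambda>f. D x1 y2 p f + D x2 y1 p f) f = D x1 y1 p f - D x2 y2 p f" if p: "p \<in> U" for p f
  proof -
    note t = VF_tangent[OF _ p]
    \<comment> \<open>The eigenvalue relations hold on \<open>U\<close> only, so they are
      substituted inside D by locality.\<close>
    have l: "D (PF x1) Z p f = - D x2 Z p f" if "VF Z" for Z f
      using D_cong_left[OF Phi_VF[OF V(1)] that p xe(1), of f] D_uminus_left[OF V(2) that p, of f]
          by simp
    have r1: "D Z (PF y1) p f = - D Z y2 p f" if "VF Z" for Z f
      using D_cong_right[OF that Phi_VF[OF V(3)] p ye(1), of f]
          D_uminus_right[OF that V(4) p, of f] by simp
    have r2: "D Z (PF y2) p f = D Z y1 p f" if "VF Z" for Z f
      using D_cong_right[OF that Phi_VF[OF V(4)] p ye(2), of f] by simp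
    have r3: "D Z (PF (PF y1)) p f = - D Z y1 p f" if "VF Z" for Z f
      using D_cong_right[OF that Phi_VF[OF Phi_VF[OF V(3)]] p ye(3), of f]
        D_uminus_right[OF that V(3) p, of f] by simp
    have r4: "D Z (PF (PF y2)) p f = - D Z y2 p f" if "VF Z" for Z f
      using D_cong_right[OF that Phi_VF[OF Phi_VF[OF V(4)]] p ye(4), of f]
        D_uminus_right[OF that V(4) p, of f] by simp
    have a: "D (PF x1) (PF y1) p = (\<lambda>f. D x2 y2 p f)"
      using l[OF Phi_VF[OF V(3)]] r1[OF V(2)] by auto
    have b: "D (PF x1) (PF y2) p = (\<lambda>f. - D x2 y1 p f)"
      using l[OF Phi_VF[OF V(4)]] r2[OF V(2)] by auto
    show "\<Phi> p (\<lambda>f. D x1 y1 p f - D x2 y2 p f) f = - (D x1 y2 p f + D x2 y1 p f)"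
      using kenmotsu_local[OF V(1,3) p, of f]
      unfolding a l[OF Phi_VF[OF Phi_VF[OF V(3)]]] r1[OF V(1)] r3[OF V(2)] type10_eta(1)[OF y p]
      by (simp add: Phi_minus t D_VF V)
    show "\<Phi> p (\<lambda>f. D x1 y2 p f + D x2 y1 p f) f = D x1 y1 p f - D x2 y2 p f"
      using kenmotsu_local[OF V(1,4) p, of f]
      unfolding b l[OF Phi_VF[OF Phi_VF[OF V(4)]]] r2[OF V(1)] r4[OF V(2)] type10_eta(2)[OF y p]
      by (simp add: Phi_plus Phi_uminus t D_VF V)
  qed
  show ?thesis
    unfolding type10_def using eqs V by (auto intro!: vfield_on_diff vfield_on_add D_VF)
qed

lemma type10_diff:
  assumes x: "type10 x1 x2" and y: "type10 y1 y2"
  shows "type10 (\<lambda>p f. x1 p f - y1 p f) (\<lambda>p f. x2 p f - y2 p f)"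
  unfolding type10_def
proof (intro conjI ballI)
  have V: "VF x1" "VF x2" "VF y1" "VF y2" using x y by (auto simp: type10_def)
  then show "VF (\<lambda>p f. x1 p f - y1 p f)" "VF (\<lambda>p f. x2 p f - y2 p f)"
    by (auto intro: vfield_on_diff)
  fix p assume p: "p \<in> U"
  show "\<Phi> p (\<lambda>f. x1 p f - y1 p f) = (\<lambda>f. - (x2 p f - y2 p f))"
    "\<Phi> p (\<lambda>f. x2 p f - y2 p f) = (\<lambda>f. x1 p f - y1 p f)"
    using x y p by (simp_all add: Phi_minus VF_tangent[OF _ p] V type10_def fun_eq_iff)
qed

lemma type10_cong:
  assumes "type10 x1 x2" "\<And>p. p \<in> U \<Longrightarrow> x1 p = y1 p" "\<And>p. p \<in> U \<Longrightarrow> x2 p = y2 p"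
  shows "type10 y1 y2"
proof -
  have "VF y1" "VF y2"
    using assms(1) vfield_on_cong[of U x1 y1] vfield_on_cong[of U x2 y2] assms(2,3)
    by (auto simp: type10_def)
  then show ?thesis
    using assms by (auto simp: type10_def)
qed

text \<open>On fields orthogonal to \<xi> the metric is Phi-invariant, so g(X,Y) = g(iX,iY) =
  -g(X,Y). The two equations are the real and imaginary parts of g(X,Y) = 0.\<close>

lemma type10_isotropic:
  assumes x: "type10 x1 x2" and y: "type10 y1 y2" and p: "p \<in> U"
  shows "g p (x1 p) (y1 p) = g p (x2 p) (y2 p)" "g p (x1 p) (y2 p) = - g p (x2 p) (y1 p)"
proof -
  have V: "VF x1" "VF x2" "VF y1" "VF y2" using x y by (auto simp: type10_def)
  note t = V[THEN VF_tangent, OF p]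
  have e: "\<Phi> p (x1 p) = (\<lambda>f. - x2 p f)" "\<Phi> p (y1 p) = (\<lambda>f. - y2 p f)" "\<Phi> p (y2 p) = y1 p"
    using x y p by (auto simp: type10_def)
  show "g p (x1 p) (y1 p) = g p (x2 p) (y2 p)"
    using g_Phi_Phi[OF t(1,3)] unfolding e type10_eta(1)[OF x p]
    by (simp add: g_uminus_left g_uminus_right tangent_uminus t)
  show "g p (x1 p) (y2 p) = - g p (x2 p) (y1 p)"
    using g_Phi_Phi[OF t(1,4)] unfolding e type10_eta(1)[OF x p]
    by (simp add: g_uminus_left g_uminus_right tangent_uminus t)
qed

end

section \<open>Complex fields\<close>

lemma ReV_ext2: "ReV (ext2 op Z W) = (\<lambda>p f. op (ReV Z) (ReV W) p f - op (ImV Z) (ImV W) p f)"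
  and ImV_ext2: "ImV (ext2 op Z W) = (\<lambda>p f. op (ReV Z) (ImV W) p f + op (ImV Z) (ReV W) p f)"
  by (simp_all add: ReV_def ImV_def ext2_def)

lemma gC_Re: "Re (gC g p (Z p) (W p)) = g p (ReV Z p) (ReV W p) - g p (ImV Z p) (ImV W p)"
  and gC_Im: "Im (gC g p (Z p) (W p)) = g p (ReV Z p) (ImV W p) + g p (ImV Z p) (ReV W p)"
  by (simp_all add: gC_def ReV_def ImV_def)

definition cnjV :: "'m cvfield \<Rightarrow> 'm cvfield" where
  "cnjV Z = (\<lambda>p f. cnj (Z p f))"

lemma ReV_cnjV [simp]: "ReV (cnjV Z) = ReV Z"
  and ImV_cnjV [simp]: "ImV (cnjV Z) = (\<lambda>p f. - ImV Z p f)"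
  by (simp_all add: ReV_def ImV_def cnjV_def)

context riemannian_region
begin

abbreviation CVF :: "'m cvfield \<Rightarrow> bool" where "CVF \<equiv> cvfield_on A U"

section \<open>The complex curvature and its symmetries\<close>

lemma CVF_parts: "CVF Z \<Longrightarrow> VF (ReV Z)" "CVF Z \<Longrightarrow> VF (ImV Z)"
  by (auto simp: cvfield_on_def)

lemma CVF_cnjV: "CVF Z \<Longrightarrow> CVF (cnjV Z)"
  by (simp add: cvfield_on_def VF_uminus)

text \<open>\<open>curv\<close> nests bilinear extensions; additivity of D over \<open>U\<close>
  rearranges them into the trilinear extension of \<open>rcurv\<close>.\<close>

lemma ReV_curv:
  assumes X: "CVF X" and Y: "CVF Y" and Z: "CVF Z" and p: "p \<in> U"
  shows "ReV (curv A D X Y Z) p f =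
      rcurv A D (ReV X) (ReV Y) (ReV Z) p f - rcurv A D (ReV X) (ImV Y) (ImV Z) p f
      - rcurv A D (ImV X) (ReV Y) (ImV Z) p f - rcurv A D (ImV X) (ImV Y) (ReV Z) p f"
    and "ImV (curv A D X Y Z) p f =
      rcurv A D (ReV X) (ReV Y) (ImV Z) p f + rcurv A D (ReV X) (ImV Y) (ReV Z) p f
      + rcurv A D (ImV X) (ReV Y) (ReV Z) p f - rcurv A D (ImV X) (ImV Y) (ImV Z) p f"
proof -
  note V = CVF_parts[OF X] CVF_parts[OF Y] CVF_parts[OF Z]
  have "ReV (curv A D X Y Z) p f = ReV (ext2 D X (ext2 D Y Z)) p f - ReV (ext2 D Y (ext2 D X Z)) p f
      - ReV (ext2 D (ext2 (lie_bracket A) X Y) Z) p f"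
    by (simp add: ReV_def curv_def)
  then show "ReV (curv A D X Y Z) p f =
      rcurv A D (ReV X) (ReV Y) (ReV Z) p f - rcurv A D (ReV X) (ImV Y) (ImV Z) p f
      - rcurv A D (ImV X) (ReV Y) (ImV Z) p f - rcurv A D (ImV X) (ImV Y) (ReV Z) p f"
    unfolding ReV_ext2 ImV_ext2
    by (simp add: D_diff_right D_add_right D_diff_left D_add_left D_VF bracket_VF V p rcurv_def)
  have "ImV (curv A D X Y Z) p f = ImV (ext2 D X (ext2 D Y Z)) p f - ImV (ext2 D Y (ext2 D X Z)) p f
      - ImV (ext2 D (ext2 (lie_bracket A) X Y) Z) p f"
    by (simp add: ImV_def curv_def)
  then show "ImV (curv A D X Y Z) p f =
      rcurv A D (ReV X) (ReV Y) (ImV Z) p f + rcurv A D (ReV X) (ImV Y) (ReV Z) p f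
      + rcurv A D (ImV X) (ReV Y) (ReV Z) p f - rcurv A D (ImV X) (ImV Y) (ImV Z) p f"
    unfolding ReV_ext2 ImV_ext2
    by (simp add: D_diff_right D_add_right D_diff_left D_add_left D_VF bracket_VF V p rcurv_def)
qed

lemma curv_CVF:
  assumes X: "CVF X" and Y: "CVF Y" and Z: "CVF Z"
  shows "CVF (curv A D X Y Z)"
proof -
  note V = CVF_parts[OF X] CVF_parts[OF Y] CVF_parts[OF Z]
  have "VF (ReV (curv A D X Y Z))"
    by (rule vfield_on_cong[where X = "\<lambda>p f. rcurv A D (ReV X) (ReV Y) (ReV Z) p f
        - rcurv A D (ReV X) (ImV Y) (ImV Z) p f
        - rcurv A D (ImV X) (ReV Y) (ImV Z) p f - rcurv A D (ImV X) (ImV Y) (ReV Z) p f"])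
      (auto intro!: vfield_on_diff rcurv_VF V simp: ReV_curv[OF assms] fun_eq_iff)
  moreover have "VF (ImV (curv A D X Y Z))"
    by (rule vfield_on_cong[where X = "\<lambda>p f. rcurv A D (ReV X) (ReV Y) (ImV Z) p f
        + rcurv A D (ReV X) (ImV Y) (ReV Z) p f
        + rcurv A D (ImV X) (ReV Y) (ReV Z) p f - rcurv A D (ImV X) (ImV Y) (ImV Z) p f"])
      (auto intro!: vfield_on_diff vfield_on_add rcurv_VF V simp: ReV_curv[OF assms] fun_eq_iff)
  ultimately show ?thesis by (simp add: cvfield_on_def)
qed

definition CR :: "'m cvfield \<Rightarrow> 'm cvfield \<Rightarrow> 'm cvfield \<Rightarrow> 'm cvfield \<Rightarrow> 'm \<Rightarrow> complex" where
  "CR X Y Z W p = gC g p (curv A D X Y Z p) (W p)"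

text \<open>With this expansion each symmetry below becomes a linear consequence of the same
  symmetry of the sixteen real terms.\<close>

lemma CR_expand:
  assumes X: "CVF X" and Y: "CVF Y" and Z: "CVF Z" and W: "CVF W" and p: "p \<in> U"
  shows "CR X Y Z W p = Complex
     (Rm (ReV X) (ReV Y) (ReV Z) (ReV W) p - Rm (ReV X) (ImV Y) (ImV Z) (ReV W) p
      - Rm (ImV X) (ReV Y) (ImV Z) (ReV W) p - Rm (ImV X) (ImV Y) (ReV Z) (ReV W) p
      - (Rm (ReV X) (ReV Y) (ImV Z) (ImV W) p + Rm (ReV X) (ImV Y) (ReV Z) (ImV W) p
      + Rm (ImV X) (ReV Y) (ReV Z) (ImV W) p - Rm (ImV X) (ImV Y) (ImV Z) (ImV W) p))
     (Rm (ReV X) (ReV Y) (ReV Z) (ImV W) p - Rm (ReV X) (ImV Y) (ImV Z) (ImV W) p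
      - Rm (ImV X) (ReV Y) (ImV Z) (ImV W) p - Rm (ImV X) (ImV Y) (ReV Z) (ImV W) p
      + (Rm (ReV X) (ReV Y) (ImV Z) (ReV W) p + Rm (ReV X) (ImV Y) (ReV Z) (ReV W) p
      + Rm (ImV X) (ReV Y) (ReV Z) (ReV W) p - Rm (ImV X) (ImV Y) (ImV Z) (ReV W) p))"
proof -
  note V = CVF_parts[OF X] CVF_parts[OF Y] CVF_parts[OF Z] CVF_parts[OF W]
  have eq: "ReV (curv A D X Y Z) p = (\<lambda>f. rcurv A D (ReV X) (ReV Y) (ReV Z) p f
      - rcurv A D (ReV X) (ImV Y) (ImV Z) p f
      - rcurv A D (ImV X) (ReV Y) (ImV Z) p f - rcurv A D (ImV X) (ImV Y) (ReV Z) p f)"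
    "ImV (curv A D X Y Z) p = (\<lambda>f. rcurv A D (ReV X) (ReV Y) (ImV Z) p f
        + rcurv A D (ReV X) (ImV Y) (ReV Z) p f
      + rcurv A D (ImV X) (ReV Y) (ReV Z) p f - rcurv A D (ImV X) (ImV Y) (ImV Z) p f)"
    using ReV_curv[OF X Y Z p] by auto
  show ?thesis
    unfolding complex_eq_iff CR_def gC_Re gC_Im eq
    by (simp add: g_diff_left g_add_left tangent_minus tangent_plus VF_tangent[OF _ p] rcurv_VF V
        Rm_def)
qed

context
  fixes X Y Z W :: "'m cvfield" and p :: 'm
  assumes X: "CVF X" and Y: "CVF Y" and Z: "CVF Z" and W: "CVF W" and p: "p \<in> U"
begin

lemma VFs: "a \<in> {ReV X, ImV X} \<Longrightarrow> VF a" "a \<in> {ReV Y, ImV Y} \<Longrightarrow> VF a"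
  "a \<in> {ReV Z, ImV Z} \<Longrightarrow> VF a" "a \<in> {ReV W, ImV W} \<Longrightarrow> VF a"
  using X Y Z W by (auto simp: cvfield_on_def)

lemma CR_skew1: "CR X Y Z W p = - CR Y X Z W p"
proof -
  \<comment> \<open>The membership premises orient the rule: it fires only when the arguments are
    parts of X, Y, Z, W in this order, so rewriting does not loop.\<close>
  have "Rm a b c d p = - Rm b a c d p"
    if "a \<in> {ReV X, ImV X}" "b \<in> {ReV Y, ImV Y}" "c \<in> {ReV Z, ImV Z}" "d \<in> {ReV W, ImV W}" for a b
        c d
    using that by (intro Rm_skew1 VFs p)
  then show ?thesis
    by (simp add: CR_expand X Y Z W p complex_eq_iff)
qed

lemma CR_skew2: "CR X Y Z W p = - CR X Y W Z p"
proof -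
  have "Rm a b c d p = - Rm a b d c p"
    if "a \<in> {ReV X, ImV X}" "b \<in> {ReV Y, ImV Y}" "c \<in> {ReV Z, ImV Z}" "d \<in> {ReV W, ImV W}" for a b
        c d
    using that by (intro Rm_skew2 VFs p)
  then show ?thesis
    by (simp add: CR_expand X Y Z W p complex_eq_iff)
qed

lemma CR_pair: "CR X Y Z W p = CR Z W X Y p"
proof -
  \<comment> \<open>A neutral name to which the real terms of both sides are rewritten.\<close>
  define K where "K a b c d = Rm a b c d p" for a b c d
  have "Rm a b c d p = K a b c d" "Rm c d a b p = K a b c d"
    if "a \<in> {ReV X, ImV X}" "b \<in> {ReV Y, ImV Y}" "c \<in> {ReV Z, ImV Z}" "d \<in> {ReV W, ImV W}" for a b
        c d
    using Rm_pair[OF VFs(1)[OF that(1)] VFs(2)[OF that(2)] VFs(3)[OF that(3)] VFs(4)[OF that(4)] p]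
    by (simp_all add: K_def)
  note K = this
  show ?thesis
    by (simp add: K CR_expand X Y Z W p complex_eq_iff)
qed

lemma CR_bianchi: "CR X Y Z W p + CR Y Z X W p + CR Z X Y W p = 0"
proof -
  have "Rm a b c d p = - Rm b c a d p - Rm c a b d p"
    if "a \<in> {ReV X, ImV X}" "b \<in> {ReV Y, ImV Y}" "c \<in> {ReV Z, ImV Z}" "d \<in> {ReV W, ImV W}" for a b
        c d
    using Rm_bianchi[OF VFs(1)[OF that(1)] VFs(2)[OF that(2)] VFs(3)[OF that(3)] VFs(4)[OF that(4)]
        p]
    by linarith
  then show ?thesis
    by (simp add: CR_expand X Y Z W p complex_eq_iff)
qed

end

text \<open>In the last slot the sign rule is linearity of the metric; the skew and pair symmetries
  carry it to the other slots. Conjugation changes the signs of imaginary parts, which is where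
  these rules are used.\<close>

lemma Rm_uminus4: "VF X \<Longrightarrow> VF Y \<Longrightarrow> VF Z \<Longrightarrow> VF W \<Longrightarrow> p \<in> U \<Longrightarrow>
    Rm X Y Z (\<lambda>q f. - W q f) p = - Rm X Y Z W p"
  unfolding Rm_def by (simp add: g_uminus_right VF_tangent rcurv_VF)

lemma Rm_uminus3: "VF X \<Longrightarrow> VF Y \<Longrightarrow> VF Z \<Longrightarrow> VF W \<Longrightarrow> p \<in> U \<Longrightarrow>
    Rm X Y (\<lambda>q f. - Z q f) W p = - Rm X Y Z W p"
  using Rm_skew2[of X Y "\<lambda>q f. - Z q f" W p] Rm_skew2[of X Y W Z p] Rm_uminus4[of X Y W Z p]
  by (simp add: VF_uminus)

lemma Rm_uminus2: "VF X \<Longrightarrow> VF Y \<Longrightarrow> VF Z \<Longrightarrow> VF W \<Longrightarrow> p \<in> U \<Longrightarrow>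
    Rm X (\<lambda>q f. - Y q f) Z W p = - Rm X Y Z W p"
  using Rm_pair[of X "\<lambda>q f. - Y q f" Z W p] Rm_pair[of X Y Z W p] Rm_uminus4[of Z W X Y p]
  by (simp add: VF_uminus)

lemma Rm_uminus1: "VF X \<Longrightarrow> VF Y \<Longrightarrow> VF Z \<Longrightarrow> VF W \<Longrightarrow> p \<in> U \<Longrightarrow>
    Rm (\<lambda>q f. - X q f) Y Z W p = - Rm X Y Z W p"
  using Rm_pair[of "\<lambda>q f. - X q f" Y Z W p] Rm_pair[of X Y Z W p] Rm_uminus3[of Z W X Y p]
  by (simp add: VF_uminus)

lemma CR_cnjV:
  assumes "CVF X" "CVF Y" "CVF Z" "CVF W" "p \<in> U"
  shows "CR (cnjV X) (cnjV Y) (cnjV Z) (cnjV W) p = cnj (CR X Y Z W p)"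
  by (simp add: CR_expand assms CVF_cnjV CVF_parts VF_uminus complex_eq_iff
      Rm_uminus1 Rm_uminus2 Rm_uminus3 Rm_uminus4)

section \<open>Complex tangent vectors and the complex bilinear metric\<close>

lemma ctangent_parts:
  "z \<in> ctangent A p \<Longrightarrow> (\<lambda>f. Re (z f)) \<in> tangent A p"
  "z \<in> ctangent A p \<Longrightarrow> (\<lambda>f. Im (z f)) \<in> tangent A p"
  by (simp_all add: ctangent_def)

lemma CVF_ctangent: "CVF Z \<Longrightarrow> p \<in> U \<Longrightarrow> Z p \<in> ctangent A p"
  using VF_tangent[of "ReV Z" p] VF_tangent[of "ImV Z" p]
  by (simp add: cvfield_on_def ctangent_def ReV_def ImV_def)

lemma ctangent_zero: "(\<lambda>f. 0) \<in> ctangent A p"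
  by (simp add: ctangent_def tangent_zero)

lemma ctangent_plus: "z \<in> ctangent A p \<Longrightarrow> w \<in> ctangent A p \<Longrightarrow> (\<lambda>f. z f + w f) \<in> ctangent A p"
  by (simp add: ctangent_def tangent_plus)

lemma ctangent_scale: "z \<in> ctangent A p \<Longrightarrow> (\<lambda>f. c * z f) \<in> ctangent A p"
  by (simp add: ctangent_def tangent_plus tangent_minus tangent_scale)

lemma gC_plus_left:
  assumes "z \<in> ctangent A p" "w \<in> ctangent A p" "u \<in> ctangent A p"
  shows "gC g p (\<lambda>f. z f + w f) u = gC g p z u + gC g p w u"
  using assms by (simp add: gC_def complex_eq_iff g_add_left ctangent_parts)

lemma gC_scale_left:
  assumes "z \<in> ctangent A p" "u \<in> ctangent A p"
  shows "gC g p (\<lambda>f. c * z f) u = c * gC g p z u"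
  using assms by (simp add: gC_def complex_eq_iff g_add_left g_diff_left g_scale_left
      ctangent_parts tangent_scale algebra_simps)

lemma gC_zero_left: "u \<in> ctangent A p \<Longrightarrow> gC g p (\<lambda>f. 0) u = 0"
  by (simp add: gC_def complex_eq_iff g_zero_left ctangent_parts)

text \<open>The two claims share one induction, because additivity of the metric requires the
  partial sum to be a tangent vector.\<close>

lemma gC_sum_left:
  assumes "\<And>i. i \<in> I \<Longrightarrow> z i \<in> ctangent A p" "u \<in> ctangent A p"
  shows "gC g p (\<lambda>f. \<Sum>i\<in>I. c i * z i f) u = (\<Sum>i\<in>I. c i * gC g p (z i) u)"
    and "(\<lambda>f. \<Sum>i\<in>I. c i * z i f) \<in> ctangent A p"
  using assms(1)
proof (induction I rule: infinite_finite_induct)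
  case (insert i I)
  { case 1 with insert show ?case
      by (simp add: gC_plus_left gC_scale_left ctangent_scale assms(2)) }
  { case 2 with insert show ?case
      by (simp add: ctangent_plus ctangent_scale) }
qed (simp_all add: gC_zero_left assms(2) ctangent_zero)

lemma g_sum_left:
  assumes "\<And>i. i \<in> I \<Longrightarrow> x i \<in> tangent A p" "u \<in> tangent A p"
  shows "g p (\<lambda>f. \<Sum>i\<in>I. c i * x i f) u = (\<Sum>i\<in>I. c i * g p (x i) u)"
    and "(\<lambda>f. \<Sum>i\<in>I. c i * x i f) \<in> tangent A p"
  using assms(1)
proof (induction I rule: infinite_finite_induct)
  case (insert i I)
  { case 1 with insert show ?case
      by (simp add: g_add_left g_scale_left tangent_scale assms(2)) }
  { case 2 with insert show ?case
      by (simp add: tangent_plus tangent_scale) }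
qed (simp_all add: g_zero_left assms(2) tangent_zero)

end

context kenmotsu_region
begin

section \<open>Curvature on the complex eigenbundle and on \<xi>\<close>

definition ctype10 :: "'m cvfield \<Rightarrow> bool" where
  "ctype10 Z \<longleftrightarrow> type10 (ReV Z) (ImV Z)"

lemma ctype10_CVF: "ctype10 Z \<Longrightarrow> CVF Z"
  by (simp add: ctype10_def type10_def cvfield_on_def)

lemma ctype10_D: "ctype10 X \<Longrightarrow> ctype10 Y \<Longrightarrow> ctype10 (ext2 D X Y)"
  unfolding ctype10_def ReV_ext2 ImV_ext2 by (rule type10_D)

lemma ctype10_diff:
  "ctype10 X \<Longrightarrow> ctype10 Y \<Longrightarrow> ctype10 (\<lambda>p f. X p f - Y p f)"
  using type10_diff[of "ReV X" "ImV X" "ReV Y" "ImV Y"] by (simp add: ctype10_def ReV_def ImV_def)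

text \<open>Involutivity follows from zero torsion: the bracket is nabla_X Y - nabla_Y X, and both
  terms lie in the bundle.\<close>

lemma ctype10_bracket:
  assumes X: "ctype10 X" and Y: "ctype10 Y"
  shows "ctype10 (ext2 (lie_bracket A) X Y)"
proof -
  note V = CVF_parts[OF ctype10_CVF[OF X]] CVF_parts[OF ctype10_CVF[OF Y]]
  have "ctype10 (\<lambda>p f. ext2 D X Y p f - ext2 D Y X p f)"
    by (intro ctype10_diff ctype10_D X Y)
  then have *: "type10 (\<lambda>p f. ReV (ext2 D X Y) p f - ReV (ext2 D Y X) p f)
      (\<lambda>p f. ImV (ext2 D X Y) p f - ImV (ext2 D Y X) p f)"
    by (simp add: ctype10_def ReV_def ImV_def)
  show ?thesis
    unfolding ctype10_def
    by (rule type10_cong[OF *]) (auto simp: ReV_ext2 ImV_ext2 fun_eq_iff D_torsion V)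
qed

lemma CR_ctype10:
  assumes X: "ctype10 X" and Y: "ctype10 Y" and Z: "ctype10 Z" and W: "ctype10 W" and p: "p \<in> U"
  shows "CR X Y Z W p = 0"
proof -
  have "ctype10 (curv A D X Y Z)"
    unfolding curv_def by (intro ctype10_diff ctype10_D ctype10_bracket X Y Z)
  from type10_isotropic[OF this[unfolded ctype10_def] W[unfolded ctype10_def] p]
  show ?thesis
    unfolding CR_def complex_eq_iff gC_Re gC_Im by simp
qed

lemma Rm_xi:
  assumes "VF X" "VF Y" "VF W" "p \<in> U"
  shows "Rm X Y \<xi> W p = g p (X p) (\<xi> p) * g p (Y p) (W p) - g p (Y p) (\<xi> p) * g p (X p) (W p)"
proof -
  have "rcurv A D X Y \<xi> p = (\<lambda>f. g p (X p) (\<xi> p) * Y p f - g p (Y p) (\<xi> p) * X p f)"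
    using rcurv_xi[OF assms(1,2,4)] by auto
  then show ?thesis
    unfolding Rm_def using assms by (simp add: g_diff_left g_scale_left tangent_scale VF_tangent)
qed

text \<open>The zero field is its own negative, so the value is too.\<close>

lemma Rm_zero3: "VF X \<Longrightarrow> VF Y \<Longrightarrow> VF W \<Longrightarrow> p \<in> U \<Longrightarrow> Rm X Y (\<lambda>q f. 0) W p = 0"
  using Rm_uminus3[of X Y "\<lambda>q f. 0" W p] vfield_on_zero by simp

lemma CR_xi:
  assumes X: "CVF X" and Y: "CVF Y" and W: "CVF W" and p: "p \<in> U"
    and Z: "ReV Z = \<xi>" "ImV Z = (\<lambda>q f. 0)"
  shows "CR X Y Z W p = gC g p (X p) (Z p) * gC g p (Y p) (W p)
      - gC g p (Y p) (Z p) * gC g p (X p) (W p)"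
proof -
  have "CVF Z" using Z xi_VF vfield_on_zero by (simp add: cvfield_on_def)
  note V = CVF_parts[OF X] CVF_parts[OF Y] CVF_parts[OF W]
  show ?thesis
    unfolding CR_expand[OF X Y \<open>CVF Z\<close> W p] Z complex_eq_iff gC_Re gC_Im times_complex.sel
        minus_complex.sel
    by (simp add: Rm_xi Rm_zero3 V p g_zero_right VF_tangent algebra_simps)
qed

end

section \<open>The algebra of components in an A-frame\<close>

lemma hat_simps [simp]: "hat n 0 = 0" "i \<le> 2 * n \<Longrightarrow> hat n i \<le> 2 * n" "i \<le> 2 * n \<Longrightarrow>
    hat n (hat n i) = i"
  "a \<in> {1..n} \<Longrightarrow> hat n a = a + n" "a \<in> {1..n} \<Longrightarrow> hat n (a + n) = a"
  by (auto simp: hat_def)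

lemma hat_eq_iff: "i \<le> 2 * n \<Longrightarrow> j \<le> 2 * n \<Longrightarrow> hat n i = hat n j \<longleftrightarrow> i = j"
  by (metis hat_simps(3))

lemma hat_flip: "i \<le> 2 * n \<Longrightarrow> j \<le> 2 * n \<Longrightarrow> j = hat n i \<longleftrightarrow> i = hat n j"
  by (metis hat_simps(3))

lemma sum_hat: "(\<Sum>i\<le>2*n. F (hat n i)) = (\<Sum>i\<le>2*n. F i)"
  by (rule sum.reindex_bij_witness[where i = "hat n" and j = "hat n"]) auto

lemma index_cases:
  assumes "i \<le> 2 * n"
  obtains "i = 0" | a where "a \<in> {1..n}" "i = a" | a where "a \<in> {1..n}" "i = hat n a"
proof -
  consider "i = 0" | "i \<noteq> 0" "i \<le> n" | "\<not> i \<le> n" by linarith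
  then show thesis
  proof cases
    case 3
    then have "i - n \<in> {1..n}" "i = hat n (i - n)" using assms by (auto simp: hat_def)
    then show ?thesis by (rule that(3))
  qed (use that in auto)
qed

lemma sum_index_split: "(\<Sum>i\<le>2*n. F i) = F 0 + (\<Sum>a=1..n. F a + F (a + n))"
  for F :: "nat \<Rightarrow> 'b::comm_monoid_add"
proof -
  have "(\<Sum>i\<le>2*n. F i) = (\<Sum>i\<in>{0} \<union> {1..n} \<union> {1+n..n+n}. F i)"
    by (rule sum.cong) auto
  also have "\<dots> = F 0 + (\<Sum>a=1..n. F a) + (\<Sum>a=1+n..n+n. F a)"
    by (subst sum.union_disjoint; (subst sum.union_disjoint)?) auto
  finally show ?thesis
    unfolding sum.shift_bounds_cl_nat_ivl by (simp add: sum.distrib add.assoc)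
qed

text \<open>These are 14 of the 16 ways to place hats on four nonzero indices. The missing ones, no
  hat and four hats, are exactly those where isotropy makes the components vanish. Three hats arise
  from one hat by conjugation.\<close>

lemma reachable_mixed:
  assumes "a \<in> {1..n}" "b \<in> {1..n}" "c \<in> {1..n}" "d \<in> {1..n}"
  shows "(hat n a, b, c, d) \<in> reachable n" "(a, hat n b, c, d) \<in> reachable n"
    "(a, b, hat n c, d) \<in> reachable n" "(a, b, c, hat n d) \<in> reachable n"
    "(hat n a, hat n b, c, d) \<in> reachable n" "(a, b, hat n c, hat n d) \<in> reachable n"
    "(hat n a, b, c, hat n d) \<in> reachable n" "(hat n a, b, hat n c, d) \<in> reachable n"
    "(a, hat n b, c, hat n d) \<in> reachable n" "(a, hat n b, hat n c, d) \<in> reachable n"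
    "(a, hat n b, hat n c, hat n d) \<in> reachable n" "(hat n a, b, hat n c, hat n d) \<in> reachable n"
    "(hat n a, hat n b, c, hat n d) \<in> reachable n" "(hat n a, hat n b, hat n c, d) \<in> reachable n"
proof -
  have one: "(hat n a, b, c, d) \<in> reachable n \<and> (a, hat n b, c, d) \<in> reachable n \<and>
    (a, b, hat n c, d) \<in> reachable n \<and> (a, b, c, hat n d) \<in> reachable n"
    if "a \<in> {1..n}" "b \<in> {1..n}" "c \<in> {1..n}" "d \<in> {1..n}" for a b c d
    using that by (meson reachable.base3 reachable.skew1 reachable.skew2 reachable.pair)
  show "(hat n a, b, c, d) \<in> reachable n" "(a, hat n b, c, d) \<in> reachable n"
    "(a, b, hat n c, d) \<in> reachable n" "(a, b, c, hat n d) \<in> reachable n"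
    using one[OF assms] by auto
  show "(hat n a, hat n b, c, d) \<in> reachable n" "(a, b, hat n c, hat n d) \<in> reachable n"
    using assms by (meson reachable.base5 reachable.pair)+
  show "(hat n a, b, c, hat n d) \<in> reachable n" "(hat n a, b, hat n c, d) \<in> reachable n"
    "(a, hat n b, c, hat n d) \<in> reachable n" "(a, hat n b, hat n c, d) \<in> reachable n"
    using assms by (meson reachable.base4 reachable.skew1 reachable.skew2)+
  note c = reachable.conj[of _ _ _ _ n]
  have h: "hat n (hat n x) = x" if "x \<in> {1..n}" for x
    using that by simp
  show "(a, hat n b, hat n c, hat n d) \<in> reachable n" "(hat n a, b, hat n c, hat n d) \<in> reachable n"
    "(hat n a, hat n b, c, hat n d) \<in> reachable n" "(hat n a, hat n b, hat n c, d) \<in> reachable n"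
    using one[OF assms] c[of "hat n a" b c d] c[of a "hat n b" c d] c[of a b "hat n c" d]
      c[of a b c "hat n d"] unfolding h[OF assms(1)] h[OF assms(2)] h[OF assms(3)] h[OF assms(4)]
    by blast+
qed

lemma reachable_zero:
  assumes "x \<in> {1..2*n}" "y \<in> {1..2*n}"
  shows "(x, 0, y, 0) \<in> reachable n" "(0, x, y, 0) \<in> reachable n"
    "(x, 0, 0, y) \<in> reachable n" "(0, x, 0, y) \<in> reachable n"
proof -
  have h: "hat n (hat n x) = x" if "x \<in> {1..n}" for x
    using that by simp
  have A: "(a, 0, b, 0) \<in> reachable n \<and> (hat n a, 0, b, 0) \<in> reachable n \<and>
      (a, 0, hat n b, 0) \<in> reachable n \<and> (hat n a, 0, hat n b, 0) \<in> reachable n"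
    if "a \<in> {1..n}" "b \<in> {1..n}" for a b
    using reachable.base1[OF that] reachable.base2[OF that] reachable.conj[of a 0 b 0 n]
      reachable.conj[of "hat n a" 0 b 0 n] unfolding h[OF that(1)] hat_simps(1) by blast
  have B: "x \<in> {1..n} \<or> (\<exists>a\<in>{1..n}. x = hat n a)" if "x \<in> {1..2*n}" for x
    using index_cases[of x n] that by fastforce
  show "(x, 0, y, 0) \<in> reachable n"
    using A B[OF assms(1)] B[OF assms(2)] by blast
  then show "(0, x, y, 0) \<in> reachable n" "(x, 0, 0, y) \<in> reachable n" "(0, x, 0, y) \<in> reachable n"
    by (meson reachable.skew1 reachable.skew2)+
qed

text \<open>The geometry at one point, reduced to an array of numbers. \<open>zero\<close> is the
  formula R(X,Y) \<xi> = eta(X) Y - eta(Y) X in an A-frame, and \<open>unhatted\<close> is the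
  isotropy of the eigenbundle.\<close>

locale kenmotsu_components =
  fixes n :: nat and R :: "nat \<Rightarrow> nat \<Rightarrow> nat \<Rightarrow> nat \<Rightarrow> complex"
  assumes skew1: "\<lbrakk>i \<le> 2*n; j \<le> 2*n; k \<le> 2*n; l \<le> 2*n\<rbrakk> \<Longrightarrow> R j i k l = - R i j k l"
    and skew2: "\<lbrakk>i \<le> 2*n; j \<le> 2*n; k \<le> 2*n; l \<le> 2*n\<rbrakk> \<Longrightarrow> R i j l k = - R i j k l"
    and pair: "\<lbrakk>i \<le> 2*n; j \<le> 2*n; k \<le> 2*n; l \<le> 2*n\<rbrakk> \<Longrightarrow> R k l i j = R i j k l"
    and bianchi: "\<lbrakk>i \<le> 2*n; j \<le> 2*n; k \<le> 2*n; l \<le> 2*n\<rbrakk> \<Longrightarrow> R i j k l + R i k l j + R i l j k = 0"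
    and conj: "\<lbrakk>i \<le> 2*n; j \<le> 2*n; k \<le> 2*n; l \<le> 2*n\<rbrakk> \<Longrightarrow>
      R (hat n i) (hat n j) (hat n k) (hat n l) = cnj (R i j k l)"
    and zero: "\<lbrakk>i \<le> 2*n; k \<le> 2*n; l \<le> 2*n\<rbrakk> \<Longrightarrow>
      R i 0 k l = of_bool (k = 0 \<and> l = hat n i) - of_bool (l = 0 \<and> k = hat n i)"
    and unhatted: "\<lbrakk>a \<in> {1..n}; b \<in> {1..n}; c \<in> {1..n}; d \<in> {1..n}\<rbrakk> \<Longrightarrow> R a b c d = 0"
begin

section \<open>Contractions of the array\<close>

definition ric :: "nat \<Rightarrow> nat \<Rightarrow> complex" where
  "ric j l = (\<Sum>i\<le>2*n. \<Sum>k\<le>2*n. g_up n i k * R i j k l)"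

definition ric_op :: "nat \<Rightarrow> nat \<Rightarrow> complex" where
  "ric_op i j = (\<Sum>k\<le>2*n. g_up n i k * ric k j)"

definition scal :: complex where
  "scal = (\<Sum>j\<le>2*n. \<Sum>l\<le>2*n. g_up n j l * ric j l)"

lemma sum_g_up: "i \<le> 2*n \<Longrightarrow> (\<Sum>k\<le>2*n. g_up n i k * F k) = F (hat n i)"
  by (simp add: g_up_def if_distrib[of "\<lambda>x. x * _"] of_bool_def cong: if_cong)

lemma ric_eq: "ric j l = (\<Sum>i\<le>2*n. R i j (hat n i) l)"
  unfolding ric_def by (rule sum.cong) (simp_all add: sum_g_up)

lemma ric_op_eq: "i \<le> 2*n \<Longrightarrow> ric_op i j = ric (hat n i) j"
  unfolding ric_op_def by (simp add: sum_g_up)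

lemma scal_eq: "scal = (\<Sum>j\<le>2*n. ric j (hat n j))"
  unfolding scal_def by (rule sum.cong) (simp_all add: sum_g_up)

text \<open>Reindexing the sum by the involution \<open>hat n\<close> exchanges the two contracted
  indices; pair symmetry then exchanges j and l.\<close>

lemma ric_sym: "j \<le> 2*n \<Longrightarrow> l \<le> 2*n \<Longrightarrow> ric j l = ric l j"
  unfolding ric_eq
  by (subst sum_hat[symmetric]) (auto intro!: sum.cong simp: pair[of _ j _ l])

lemma ric_conj:
  assumes "j \<le> 2*n" "l \<le> 2*n"
  shows "ric (hat n j) (hat n l) = cnj (ric j l)"
proof -
  have "ric (hat n j) (hat n l) = (\<Sum>i\<le>2*n. R (hat n i) (hat n j) (hat n (hat n i)) (hat n l))"
    unfolding ric_eq by (rule sum_hat[symmetric])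
  also have "\<dots> = (\<Sum>i\<le>2*n. cnj (R i j (hat n i) l))"
    using assms by (intro sum.cong) (simp_all add: conj del: hat_simps(3))
  finally show ?thesis by (simp add: ric_eq)
qed

text \<open>Needed for the conjugation symmetry of B, where the scalar curvature appears as a
  factor.\<close>

lemma scal_real: "cnj scal = scal"
proof -
  have "cnj scal = (\<Sum>j\<le>2*n. ric (hat n j) (hat n (hat n j)))"
    unfolding scal_eq cnj_sum by (rule sum.cong) (simp_all add: ric_conj del: hat_simps(3))
  also have "\<dots> = scal"
    unfolding scal_eq by (rule sum_hat)
  finally show ?thesis .
qed

text \<open>For l = 0 each of the 2n indices i > 0 contributes -1, while i = 0 contributes 1 -
  1.\<close>

lemma ric_zero: "l \<le> 2*n \<Longrightarrow> ric 0 l = - of_bool (l = 0) * (2 * of_nat n)"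
proof -
  assume l: "l \<le> 2*n"
  have "ric 0 l = (\<Sum>i\<le>2*n. of_bool (i = 0) * of_bool (l = 0) - of_bool (l = 0))"
    unfolding ric_eq
  proof (rule sum.cong)
    fix i assume "i \<in> {..2*n}"
    then show "R i 0 (hat n i) l = of_bool (i = 0) * of_bool (l = 0) - of_bool (l = 0)"
      using l zero[of i "hat n i" l] hat_eq_iff[of i n 0] by (auto simp: of_bool_def)
  qed simp
  also have "\<dots> = - of_bool (l = 0) * (2 * of_nat n)"
    by (simp add: sum_subtractf sum_distrib_right[symmetric] algebra_simps)
  finally show ?thesis .
qed

section \<open>The generalized curvature: symmetries, vanishing, listed components\<close>

definition G :: "nat \<Rightarrow> nat \<Rightarrow> complex" where
  "G i j = of_bool (j = hat n i)"

lemma G_sym: "i \<le> 2*n \<Longrightarrow> j \<le> 2*n \<Longrightarrow> G i j = G j i"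
  unfolding G_def using hat_flip[of i n j] by simp

lemma G_conj: "i \<le> 2*n \<Longrightarrow> j \<le> 2*n \<Longrightarrow> G (hat n i) (hat n j) = cnj (G i j)"
  unfolding G_def using hat_eq_iff[of j n "hat n i"] by (simp add: of_bool_def)

definition BC :: "real \<Rightarrow> real \<Rightarrow> real \<Rightarrow> nat \<Rightarrow> nat \<Rightarrow> nat \<Rightarrow> nat \<Rightarrow> complex" where
  "BC a0 a1 a2 i j k l = of_real a0 * R i j k l
     + of_real a1 * (G i k * ric j l - G i l * ric j k + ric i k * G j l - ric i l * G j k)
     + 2 * of_real a2 * scal * (G i k * G j l - G i l * G j k)"

context
  fixes a0 a1 a2 :: real
begin

abbreviation B where "B \<equiv> BC a0 a1 a2"

context
  fixes i j k l :: nat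
  assumes ix: "i \<le> 2*n" "j \<le> 2*n" "k \<le> 2*n" "l \<le> 2*n"
begin

lemma B_skew1: "B j i k l = - B i j k l"
  unfolding BC_def skew1[OF ix] by (simp add: algebra_simps)

lemma B_skew2: "B i j l k = - B i j k l"
  unfolding BC_def skew2[OF ix] by (simp add: algebra_simps)

lemma B_pair: "B k l i j = B i j k l"
  unfolding BC_def pair[OF ix] G_sym[OF ix(3,1)] G_sym[OF ix(3,2)] G_sym[OF ix(4,1)]
      G_sym[OF ix(4,2)]
    ric_sym[OF ix(3,1)] ric_sym[OF ix(3,2)] ric_sym[OF ix(4,1)] ric_sym[OF ix(4,2)]
  by (simp add: algebra_simps)

text \<open>Besides R there are only Kulkarni-Nomizu products of the symmetric arrays
  \<open>G\<close> and \<open>ric\<close>. Once symmetry fixes the order of their indices, the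
  cyclic sum cancels term by term.\<close>

lemma B_bianchi: "B i j k l + B i k l j + B i l j k = 0"
proof -
  have R: "R i l j k = - (R i j k l + R i k l j)"
    by (rule minus_unique[OF bianchi[OF ix], symmetric])
  show ?thesis
    unfolding BC_def R G_sym[OF ix(3,2)] G_sym[OF ix(4,2)] G_sym[OF ix(4,3)]
      ric_sym[OF ix(3,2)] ric_sym[OF ix(4,2)] ric_sym[OF ix(4,3)]
    by (simp add: algebra_simps)
qed

lemma B_conj: "B (hat n i) (hat n j) (hat n k) (hat n l) = cnj (B i j k l)"
  unfolding BC_def by (simp add: conj ric_conj G_conj ix scal_real)

end

lemma B_one_zero:
  assumes "i \<in> {1..2*n}" "k \<in> {1..2*n}" "l \<in> {1..2*n}"
  shows "B i 0 k l = 0" "B 0 i k l = 0" "B k l i 0 = 0" "B k l 0 i = 0"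
proof -
  have ix: "i \<le> 2*n" "0 \<le> 2*n" "k \<le> 2*n" "l \<le> 2*n" using assms by auto
  have G0: "G 0 x = 0" if "x \<in> {1..2*n}" for x using that by (simp add: G_def)
  show 1: "B i 0 k l = 0"
    unfolding BC_def using assms zero[OF ix(1,3,4)] ric_zero[OF ix(3)] ric_zero[OF ix(4)]
    by (simp add: G0)
  show 2: "B 0 i k l = 0"
    using B_skew1[OF ix] 1 by simp
  show "B k l i 0 = 0" "B k l 0 i = 0"
    using B_pair[OF ix] B_pair[OF ix(2,1,3,4)] 1 2 by simp_all
qed

lemma B_unhatted:
  assumes "a \<in> {1..n}" "b \<in> {1..n}" "c \<in> {1..n}" "d \<in> {1..n}"
  shows "B a b c d = 0" "B (hat n a) (hat n b) (hat n c) (hat n d) = 0"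
proof -
  have "G x y = 0" if "x \<in> {1..n}" "y \<in> {1..n}" for x y
    using that by (auto simp: G_def hat_def)
  then show "B a b c d = 0"
    unfolding BC_def using assms by (simp add: unhatted)
  then show "B (hat n a) (hat n b) (hat n c) (hat n d) = 0"
    using B_conj[of a b c d] assms by simp
qed

text \<open>Sorted by zeros in the two index pairs: a pair of zeros is killed by skew symmetry, one
  zero in each pair is reachable, a single zero gives \<open>B_one_zero\<close>, and without zeros
  only the patterns with no hat or four hats are left.\<close>

lemma B_unreachable:
  assumes ix: "i \<le> 2*n" "j \<le> 2*n" "k \<le> 2*n" "l \<le> 2*n" and nr: "(i, j, k, l) \<notin> reachable n"
  shows "B i j k l = 0"
proof -
  have pos: "x \<in> {1..2*n}" if "x \<le> 2*n" "x \<noteq> 0" for x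
    using that by simp
  have ij: "B i j k l = 0" if "i = 0" "j = 0"
    using B_skew1[OF ix] that by simp
  have kl: "B i j k l = 0" if "k = 0" "l = 0"
    using B_skew2[OF ix] that by simp
  consider "i = 0" "j = 0" | "k = 0" "l = 0"
    | "i = 0" "j \<noteq> 0" "k = 0" "l \<noteq> 0" | "i = 0" "j \<noteq> 0" "k \<noteq> 0" "l = 0"
    | "i \<noteq> 0" "j = 0" "k = 0" "l \<noteq> 0" | "i \<noteq> 0" "j = 0" "k \<noteq> 0" "l = 0"
    | "i = 0" "j \<noteq> 0" "k \<noteq> 0" "l \<noteq> 0" | "i \<noteq> 0" "j = 0" "k \<noteq> 0" "l \<noteq> 0"
    | "i \<noteq> 0" "j \<noteq> 0" "k = 0" "l \<noteq> 0" | "i \<noteq> 0" "j \<noteq> 0" "k \<noteq> 0" "l = 0"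
    | "i \<noteq> 0" "j \<noteq> 0" "k \<noteq> 0" "l \<noteq> 0"
    by blast
  then show ?thesis
  proof cases
    case 3 then show ?thesis using nr reachable_zero(4)[of j n l] ix pos by simp
  next
    case 4 then show ?thesis using nr reachable_zero(2)[of j n k] ix pos by simp
  next
    case 5 then show ?thesis using nr reachable_zero(3)[of i n l] ix pos by simp
  next
    case 6 then show ?thesis using nr reachable_zero(1)[of i n k] ix pos by simp
  next
    case 7 then show ?thesis using B_one_zero(2)[of j k l] ix pos by simp
  next
    case 8 then show ?thesis using B_one_zero(1)[of i k l] ix pos by simp
  next
    case 9 then show ?thesis using B_one_zero(4)[of l i j] ix pos by simp
  next
    case 10 then show ?thesis using B_one_zero(3)[of k i j] ix pos by simp
  next
    case 11
    have idx: "\<exists>a. a \<in> {1..n} \<and> (x = a \<or> x = hat n a)" if "x \<le> 2*n" "x \<noteq> 0" for x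
      using index_cases[OF that(1)] that(2) by metis
    obtain a where a: "a \<in> {1..n}" "i = a \<or> i = hat n a" using idx[OF ix(1) 11(1)] by blast
    obtain b where b: "b \<in> {1..n}" "j = b \<or> j = hat n b" using idx[OF ix(2) 11(2)] by blast
    obtain c where c: "c \<in> {1..n}" "k = c \<or> k = hat n c" using idx[OF ix(3) 11(3)] by blast
    obtain d where d: "d \<in> {1..n}" "l = d \<or> l = hat n d" using idx[OF ix(4) 11(4)] by blast
    show ?thesis
      using a(2) b(2) c(2) d(2) nr reachable_mixed[OF a(1) b(1) c(1) d(1)]
        B_unhatted[OF a(1) b(1) c(1) d(1)]
      by (elim disjE; hypsubst) blast+
  qed (use ij kl in auto)
qed

text \<open>The coefficient of the delta collects R_{hat a 0 b 0} = -delta, the Ricci value r_00 =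
  -2n and the term with the scalar curvature.\<close>

lemma B_zero_components:
  assumes a: "a \<in> {1..n}" and b: "b \<in> {1..n}"
  shows "B a 0 b 0 = of_real a1 * ric a b"
    and "B (hat n a) 0 b 0 = - (of_real a0 + 2 * of_nat n * of_real a1
        - 2 * of_real a2 * scal) * kd a b
      + of_real a1 * ric (hat n a) b"
proof -
  have ix: "a \<le> 2*n" "b \<le> 2*n" "hat n a \<le> 2*n" "b \<noteq> 0" "a \<noteq> 0" "b \<noteq> a + n" using a b by auto
  show "B a 0 b 0 = of_real a1 * ric a b"
    unfolding BC_def using ix zero[of a b 0] a b ric_zero[of 0] ric_zero[of b] by (simp add: G_def)
  show "B (hat n a) 0 b 0 = - (of_real a0 + 2 * of_nat n * of_real a1
      - 2 * of_real a2 * scal) * kd a b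
      + of_real a1 * ric (hat n a) b"
    unfolding BC_def using ix zero[of "hat n a" b 0] a b ric_zero[of 0] ric_zero[of b]
    by (simp add: G_def kd_def algebra_simps)
qed

text \<open>The factors 4 in the last formula cancel the two halves of the nested
  antisymmetrisations. For the product of deltas the four resulting terms coincide in pairs, so 4
  there corresponds to the 2 in front of \<open>of_real a2\<close> in \<open>BC\<close>.\<close>

lemma B_components:
  assumes a: "a \<in> {1..n}" and b: "b \<in> {1..n}" and c: "c \<in> {1..n}" and d: "d \<in> {1..n}"
  shows "B (hat n a) b c d =
      of_real a0 * R (hat n a) b c d + of_real a1 * (kd a c * ric b d - kd a d * ric b c)"
    and "B (hat n a) b c (hat n d) =
      of_real a0 * R (hat n a) b c (hat n d) + of_real a1 * (kd a c * ric_op d b + kd d b * ric_op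
          a c)
      + 2 * of_real a2 * scal * kd a c * kd d b"
    and "B (hat n a) (hat n b) c d =
      of_real a0 * R (hat n a) (hat n b) c d
      + 4 * of_real a1 * alt2 (\<lambda>a b. alt2 (\<lambda>c d. kd a c * ric_op b d) c d) a b
      + 4 * of_real a2 * scal * alt2 (\<lambda>a b. alt2 (\<lambda>c d. kd a c * kd b d) c d) a b"
proof -
  have G: "G (hat n x) y = kd x y" "G x (hat n y) = kd y x" "G x y = 0" "G (hat n x) (hat n y) = 0"
    if "x \<in> {1..n}" "y \<in> {1..n}" for x y
    using that by (auto simp: G_def kd_def of_bool_def)
  have Q: "ric_op x y = ric (hat n x) y" "ric y (hat n x) = ric (hat n x) y" 
    if "x \<in> {1..n}" "y \<in> {1..n}" for x y
    using that ric_op_eq[of x y] ric_sym[of y "hat n x"] by auto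
  show "B (hat n a) b c d =
      of_real a0 * R (hat n a) b c d + of_real a1 * (kd a c * ric b d - kd a d * ric b c)"
    unfolding BC_def G(1)[OF a c] G(1)[OF a d] G(3)[OF b c] G(3)[OF b d] by simp
  show "B (hat n a) b c (hat n d) =
      of_real a0 * R (hat n a) b c (hat n d) + of_real a1 * (kd a c * ric_op d b + kd d b * ric_op
          a c)
      + 2 * of_real a2 * scal * kd a c * kd d b"
    unfolding BC_def G(1)[OF a c] G(4)[OF a d] G(3)[OF b c] G(2)[OF b d] Q(2)[OF d b]
      Q(1)[OF d b] Q(1)[OF a c] by (simp add: algebra_simps)
  show "B (hat n a) (hat n b) c d =
      of_real a0 * R (hat n a) (hat n b) c d
      + 4 * of_real a1 * alt2 (\<lambda>a b. alt2 (\<lambda>c d. kd a c * ric_op b d) c d) a b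
      + 4 * of_real a2 * scal * alt2 (\<lambda>a b. alt2 (\<lambda>c d. kd a c * kd b d) c d) a b"
    unfolding BC_def G(1)[OF a c] G(1)[OF a d] G(1)[OF b c] G(1)[OF b d] alt2_def
      Q(1)[OF a c] Q(1)[OF a d] Q(1)[OF b c] Q(1)[OF b d]
    by (simp add: algebra_simps add_divide_distrib diff_divide_distrib)
qed

end

end

section \<open>Components in an A-frame\<close>

locale kenmotsu_frame = kenmotsu_region A g D U n \<Phi> \<xi>
  for A :: "('m::{t2_space, second_countable_topology}, 'e::euclidean_space) chart set"
    and g :: "'m metric" and D :: "'m connection" and U :: "'m set"
    and n :: nat and \<Phi> :: "'m endo" and \<xi> :: "'m vfield" +
  fixes e :: "nat \<Rightarrow> 'm vfield"
  assumes frame: "adapted_frame_on n A \<Phi> \<xi> g U e"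
begin

abbreviation \<epsilon> :: "nat \<Rightarrow> 'm cvfield" where "\<epsilon> \<equiv> aframe n \<Phi> \<xi> e"

section \<open>The A-frame and the metric in it\<close>

definition c2 :: real where "c2 = 1 / sqrt 2"

lemma c2_mult: "c2 * c2 = 1 / 2" "c2 * (c2 * x) = x / 2"
  by (simp_all add: c2_def field_simps)

lemma aframe_0: "ReV (\<epsilon> 0) = \<xi>" "ImV (\<epsilon> 0) = (\<lambda>p f. 0)"
  by (simp_all add: aframe_def ReV_def ImV_def)

lemma aframe_a:
  assumes "a \<in> {1..n}"
  shows "ReV (\<epsilon> a) = (\<lambda>p f. c2 * e a p f)"
    and "ImV (\<epsilon> a) = (\<lambda>p f. - c2 * \<Phi> p (e a p) f)"
  using assms by (simp_all add: aframe_def ReV_def ImV_def c2_def)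

lemma aframe_hat_cnjV: "i \<le> 2 * n \<Longrightarrow> \<epsilon> (hat n i) = cnjV (\<epsilon> i)"
  by (auto simp: aframe_def cnjV_def hat_def fun_eq_iff)

lemma e_VF: "a \<in> {1..n} \<Longrightarrow> VF (e a)"
  using frame by (simp add: adapted_frame_on_def)

lemma frame_orthonormal:
  assumes "p \<in> U" "i \<le> 2*n" "j \<le> 2*n"
  shows "g p (rframe n \<Phi> \<xi> e i p) (rframe n \<Phi> \<xi> e j p) = of_bool (i = j)"
  using frame assms unfolding adapted_frame_on_def by blast

lemma e_orthonormal:
  assumes p: "p \<in> U" and a: "a \<in> {1..n}" and b: "b \<in> {1..n}"
  shows "g p (e a p) (e b p) = of_bool (a = b)" "g p (e a p) (\<Phi> p (e b p)) = 0"
    "g p (\<Phi> p (e a p)) (e b p) = 0" "g p (\<Phi> p (e a p)) (\<Phi> p (e b p)) = of_bool (a = b)"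
    "g p (e a p) (\<xi> p) = 0"
  using frame_orthonormal[OF p, of a b] frame_orthonormal[OF p, of a "b + n"]
    frame_orthonormal[OF p, of "a + n" b] frame_orthonormal[OF p, of "a + n" "b + n"]
    frame_orthonormal[OF p, of a 0] a b
  by (simp_all add: rframe_def)

lemma e_ctype10: "a \<in> {1..n} \<Longrightarrow> ctype10 (\<epsilon> a)"
  unfolding ctype10_def type10_def aframe_a
proof (intro conjI ballI)
  assume a: "a \<in> {1..n}"
  show "VF (\<lambda>p f. c2 * e a p f)" "VF (\<lambda>p f. - c2 * \<Phi> p (e a p) f)"
    using vfield_on_scale[OF e_VF[OF a] smooth_fun_const[of U c2]]
      vfield_on_scale[OF Phi_VF[OF e_VF[OF a]] smooth_fun_const[of U "- c2"]] by simp_all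
  fix p assume p: "p \<in> U"
  note t = VF_tangent[OF e_VF[OF a] p]
  show "\<Phi> p (\<lambda>f. c2 * e a p f) = (\<lambda>f. - (- c2 * \<Phi> p (e a p) f))"
    unfolding Phi_scale[OF t] by simp
  show "\<Phi> p (\<lambda>f. - c2 * \<Phi> p (e a p) f) = (\<lambda>f. c2 * e a p f)"
    unfolding Phi_scale[OF Phi_tangent[OF t]] Phi_Phi[OF t] e_orthonormal(5)[OF p a a] by simp
qed

lemma aframe_CVF: "i \<le> 2*n \<Longrightarrow> CVF (\<epsilon> i)"
proof (erule index_cases)
  assume "i = 0"
  then show "CVF (\<epsilon> i)" using aframe_0 xi_VF vfield_on_zero by (simp add: cvfield_on_def)
next
  fix a assume "a \<in> {1..n}" "i = a"
  then show "CVF (\<epsilon> i)" using ctype10_CVF e_ctype10 by simp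
next
  fix a assume "a \<in> {1..n}" "i = hat n a"
  then show "CVF (\<epsilon> i)" using CVF_cnjV[OF ctype10_CVF[OF e_ctype10]] aframe_hat_cnjV[of a] by simp
qed

lemma aframe_hat_a:
  assumes "a \<in> {1..n}"
  shows "ReV (\<epsilon> (a + n)) = (\<lambda>p f. c2 * e a p f)"
    and "ImV (\<epsilon> (a + n)) = (\<lambda>p f. c2 * \<Phi> p (e a p) f)"
  using assms by (simp_all add: aframe_def ReV_def ImV_def c2_def)

lemma g_lo_aframe:
  assumes p: "p \<in> U" and i: "i \<le> 2*n" and j: "j \<le> 2*n"
  shows "g_lo g \<epsilon> p i j = of_bool (j = hat n i)"
proof -
  have t: "e a p \<in> tangent A p" "\<Phi> p (e a p) \<in> tangent A p" if "a \<in> {1..n}" for a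
    using VF_tangent[OF e_VF[OF that] p] Phi_tangent by auto
  have xe: "g p (\<xi> p) (e a p) = 0" "g p (\<xi> p) (\<Phi> p (e a p)) = 0" "g p (\<Phi> p (e a p)) (\<xi> p) = 0"
    if "a \<in> {1..n}" for a
    using e_orthonormal(5)[OF p that that] eta_Phi[OF t(1)[OF that]] g_sym[OF xi_tangent] t[OF that]
    by auto
  note simps = g_lo_def complex_eq_iff gC_Re gC_Im aframe_0 aframe_a aframe_hat_a
    g_scale_left g_scale_right g_uminus_left g_uminus_right c2_mult t tangent_scale tangent_uminus
        xi_tangent xe xi_unit g_zero_left g_zero_right
    e_orthonormal[OF p] tangent_zero
  show ?thesis
    using i
  proof (cases rule: index_cases)
    case 1
    from j show ?thesis
      by (cases rule: index_cases) (use 1 in \<open>simp_all add: simps\<close>)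
  next
    case (2 a)
    from j show ?thesis
      by (cases rule: index_cases) (use 2 in \<open>auto simp: simps\<close>)
  next
    case (3 a)
    from j show ?thesis
      by (cases rule: index_cases) (use 3 in \<open>auto simp: simps\<close>)
  qed
qed

section \<open>Frame expansions and the dual coframe\<close>

lemma tangent_expansion:
  assumes p: "p \<in> U" and x: "x \<in> tangent A p"
  shows "x f = g p x (\<xi> p) * \<xi> p f
    + (\<Sum>a=1..n. g p x (e a p) * e a p f + g p x (\<Phi> p (e a p)) * \<Phi> p (e a p) f)"
proof -
  let ?E = "rframe n \<Phi> \<xi> e"
  have tE: "?E i p \<in> tangent A p" if "i \<le> 2*n" for i
    using that
  proof (cases rule: index_cases)
    case 1 then show ?thesis by (simp add: rframe_def xi_tangent)
  next
    case (2 a) then show ?thesis using VF_tangent[OF e_VF p] by (simp add: rframe_def)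
  next
    case (3 a) then show ?thesis using Phi_tangent[OF VF_tangent[OF e_VF p]]
        by (simp add: rframe_def)
  qed
  obtain c where c: "x = (\<lambda>f. \<Sum>i\<le>2*n. c i * ?E i p f)"
    using frame p x unfolding adapted_frame_on_def by blast
  have "g p x (?E j p) = c j" if j: "j \<le> 2*n" for j
  proof -
    have "g p x (?E j p) = (\<Sum>i\<le>2*n. c i * g p (?E i p) (?E j p))"
      unfolding c by (rule g_sum_left(1)) (use tE j in auto)
    also have "\<dots> = (\<Sum>i\<le>2*n. c i * of_bool (i = j))"
      using frame_orthonormal[OF p _ j] by (intro sum.cong) auto
    finally show ?thesis using j by simp
  qed
  then have "x f = (\<Sum>i\<le>2*n. g p x (?E i p) * ?E i p f)"
    by (subst (1) c) (auto intro!: sum.cong)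
  then show ?thesis
    unfolding sum_index_split by (simp add: rframe_def)
qed

text \<open>The terms of index a and \<open>a + n\<close> add up to the real orthonormal expansion
  in \<open>e a\<close> and its image under Phi: the mixed products cancel, and the equal ones occur
  twice, against the factor 1/2 from \<open>c2 * c2\<close>.\<close>

lemma ctangent_expansion:
  assumes p: "p \<in> U" and z: "z \<in> ctangent A p"
  shows "z f = (\<Sum>j\<le>2*n. gC g p z (\<epsilon> (hat n j) p) * \<epsilon> j p f)"
proof -
  define x y where "x = (\<lambda>f. Re (z f))" and "y = (\<lambda>f. Im (z f))"
  have xy: "x \<in> tangent A p" "y \<in> tangent A p"
    using ctangent_parts[OF z] by (auto simp: x_def y_def)
  have gCz: "gC g p z (\<epsilon> i p) = Complex (g p x (ReV (\<epsilon> i) p) - g p y (ImV (\<epsilon> i) p))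
      (g p x (ImV (\<epsilon> i) p) + g p y (ReV (\<epsilon> i) p))" for i
    by (simp add: gC_def x_def y_def ReV_def ImV_def)
  have E: "\<epsilon> i p f = Complex (ReV (\<epsilon> i) p f) (ImV (\<epsilon> i) p f)" for i f
    by (simp add: ReV_def ImV_def)
  have pair: "gC g p z (\<epsilon> (hat n a) p) * \<epsilon> a p f + gC g p z (\<epsilon> (hat n (a + n)) p) * \<epsilon> (a + n) p f
      = Complex (g p x (e a p) * e a p f + g p x (\<Phi> p (e a p)) * \<Phi> p (e a p) f)
          (g p y (e a p) * e a p f + g p y (\<Phi> p (e a p)) * \<Phi> p (e a p) f)"
    if a: "a \<in> {1..n}" for a
  proof -
    have t: "e a p \<in> tangent A p" "\<Phi> p (e a p) \<in> tangent A p"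
      using VF_tangent[OF e_VF[OF a] p] Phi_tangent by auto
    show ?thesis
      unfolding gCz E hat_simps(4)[OF a] hat_simps(5)[OF a] aframe_a[OF a] aframe_hat_a[OF a]
      by (simp add: complex_eq_iff g_scale_right g_uminus_right tangent_scale xy t c2_mult
          algebra_simps)
  qed
  have S: "(\<Sum>a=1..n. gC g p z (\<epsilon> (hat n a) p) * \<epsilon> a p f + gC g p z (\<epsilon> (hat n (a + n)) p) * \<epsilon> (a
      + n) p f)
      = (\<Sum>a=1..n. Complex (g p x (e a p) * e a p f + g p x (\<Phi> p (e a p)) * \<Phi> p (e a p) f)
          (g p y (e a p) * e a p f + g p y (\<Phi> p (e a p)) * \<Phi> p (e a p) f))"
    by (rule sum.cong[OF refl pair])
  have "(\<Sum>j\<le>2*n. gC g p z (\<epsilon> (hat n j) p) * \<epsilon> j p f)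
      = Complex (x f) (y f)"
    unfolding sum_index_split S tangent_expansion[OF p xy(1), of f]
      tangent_expansion[OF p xy(2), of f] hat_simps(1) gCz[of 0] E[of 0] aframe_0
    by (simp add: complex_eq_iff g_zero_right xy)
  then show ?thesis by (simp add: x_def y_def)
qed

text \<open>Since g pairs \<epsilon> i only with its conjugate, pairing with the conjugate vector
  reads off a coordinate. This gives uniqueness in the definite description; the expansion gives
  existence.\<close>

lemma coframe_eq:
  assumes p: "p \<in> U" and z: "z \<in> ctangent A p" and i: "i \<le> 2*n"
  shows "coframe n \<epsilon> i p z = gC g p z (\<epsilon> (hat n i) p)"
proof -
  have t: "\<epsilon> j p \<in> ctangent A p" if "j \<le> 2*n" for j
    using CVF_ctangent[OF aframe_CVF[OF that] p] .
  \<comment> \<open>The value 0 beyond 2n is the one demanded by \<open>coframe\<close>; there it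
    makes the coefficients unique as a function on all naturals.\<close>
  define c where "c j = (if j \<le> 2*n then gC g p z (\<epsilon> (hat n j) p) else 0)" for j
  have "(THE c. z = (\<lambda>f. \<Sum>j\<le>2*n. c j * \<epsilon> j p f) \<and> (\<forall>j>2*n. c j = 0)) = c"
  proof (rule the_equality)
    show "z = (\<lambda>f. \<Sum>j\<le>2*n. c j * \<epsilon> j p f) \<and> (\<forall>j>2*n. c j = 0)"
    proof (intro conjI ext)
      fix f
      have "(\<Sum>j\<le>2*n. c j * \<epsilon> j p f) = (\<Sum>j\<le>2*n. gC g p z (\<epsilon> (hat n j) p) * \<epsilon> j p f)"
        by (rule sum.cong) (simp_all add: c_def)
      also have "\<dots> = z f" by (rule ctangent_expansion[OF p z, symmetric])
      finally show "z f = (\<Sum>j\<le>2*n. c j * \<epsilon> j p f)" by (rule sym)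
    qed (simp add: c_def)
  next
    fix c' assume c': "z = (\<lambda>f. \<Sum>j\<le>2*n. c' j * \<epsilon> j p f) \<and> (\<forall>j>2*n. c' j = 0)"
    have "c' j = c j" if j: "j \<le> 2*n" for j
    proof -
      have "gC g p z (\<epsilon> (hat n j) p) = (\<Sum>k\<le>2*n. c' k * gC g p (\<epsilon> k p) (\<epsilon> (hat n j) p))"
        unfolding conjunct1[OF c'] by (rule gC_sum_left(1)) (use t j in auto)
      also have "\<dots> = (\<Sum>k\<le>2*n. c' k * of_bool (k = j))"
        using g_lo_aframe[OF p, unfolded g_lo_def, of _ "hat n j"] j hat_eq_iff[OF j]
        by (intro sum.cong) auto
      finally show ?thesis using j by (simp add: c_def)
    qed
    moreover have "c' j = c j" if "\<not> j \<le> 2*n" for j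
      using conjunct2[OF c'] that by (simp add: c_def)
    ultimately show "c' = c" by blast
  qed
  then show ?thesis
    using i by (simp add: coframe_def c_def)
qed

section \<open>Curvature components in the A-frame\<close>

lemma R_lo_CR: "R_lo A g D \<epsilon> p i j k l = CR (\<epsilon> k) (\<epsilon> l) (\<epsilon> j) (\<epsilon> i) p"
  by (simp add: R_lo_def CR_def)

lemma R_up_eq:
  assumes "p \<in> U" "i \<le> 2*n" "j \<le> 2*n" "k \<le> 2*n" "l \<le> 2*n"
  shows "R_up n A D \<epsilon> p i j k l = R_lo A g D \<epsilon> p (hat n i) j k l"
  unfolding R_up_def R_lo_def using assms
  by (intro coframe_eq CVF_ctangent curv_CVF aframe_CVF)

lemma R_lo_components:
  assumes p: "p \<in> U"
  shows "kenmotsu_components n (R_lo A g D \<epsilon> p)"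
proof
  fix i j k l :: nat
  assume "i \<le> 2*n" "j \<le> 2*n" "k \<le> 2*n" "l \<le> 2*n"
  note V = this[THEN aframe_CVF]
  show "R_lo A g D \<epsilon> p j i k l = - R_lo A g D \<epsilon> p i j k l"
    unfolding R_lo_CR by (rule CR_skew2) (intro V p)+
  show "R_lo A g D \<epsilon> p i j l k = - R_lo A g D \<epsilon> p i j k l"
    unfolding R_lo_CR by (rule CR_skew1) (intro V p)+
  show "R_lo A g D \<epsilon> p k l i j = R_lo A g D \<epsilon> p i j k l"
    \<comment> \<open>\<open>R_lo\<close> lists the arguments of \<open>CR\<close> as k, l, j, i.
      Pair symmetry therefore leaves both pairs reversed, and the signs of the two swaps
      cancel.\<close>
    unfolding R_lo_CR CR_pair[OF V(3,4,2,1) p] CR_skew1[OF V(2,1,3,4) p] CR_skew2[OF V(1,2,3,4) p]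
    by simp
  show "R_lo A g D \<epsilon> p i j k l + R_lo A g D \<epsilon> p i k l j + R_lo A g D \<epsilon> p i l j k = 0"
    unfolding R_lo_CR using CR_bianchi[OF V(3,4,2,1) p] by (simp add: add_ac)
  show "R_lo A g D \<epsilon> p (hat n i) (hat n j) (hat n k) (hat n l) = cnj (R_lo A g D \<epsilon> p i j k l)"
    unfolding R_lo_CR using \<open>i \<le> 2*n\<close> \<open>j \<le> 2*n\<close> \<open>k \<le> 2*n\<close> \<open>l \<le> 2*n\<close>
    by (simp only: aframe_hat_cnjV CR_cnjV V p)
next
  fix i k l :: nat
  assume ix: "i \<le> 2*n" "k \<le> 2*n" "l \<le> 2*n"
  have "R_lo A g D \<epsilon> p i 0 k l = g_lo g \<epsilon> p k 0 * g_lo g \<epsilon> p l i - g_lo g \<epsilon> p l 0 * g_lo g \<epsilon> p k i"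
    unfolding R_lo_CR g_lo_def using ix by (intro CR_xi aframe_CVF aframe_0 p)
  then show "R_lo A g D \<epsilon> p i 0 k l = of_bool (k = 0 \<and> l = hat n i) - of_bool (l = 0 \<and> k = hat n i)"
    using ix by (auto simp: g_lo_aframe[OF p] hat_flip[of _ n 0] hat_flip[of _ n i] simp flip:
        of_bool_conj)
next
  fix a b c d
  assume "a \<in> {1..n}" "b \<in> {1..n}" "c \<in> {1..n}" "d \<in> {1..n}"
  then show "R_lo A g D \<epsilon> p a b c d = 0"
    unfolding R_lo_CR by (intro CR_ctype10 e_ctype10 p)
qed

end

theorem theorem3p1:
  fixes n :: nat
    and A :: "('m::{t2_space, second_countable_topology}, 'e::euclidean_space) chart set"
    and \<Phi> :: "'m endo" and \<xi> :: "'m vfield" and g :: "'m metric" and D :: "'m connection"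
    and a0 a1 a2 :: real
    and U :: "'m set" and e :: "nat \<Rightarrow> 'm vfield" and \<epsilon> :: "nat \<Rightarrow> 'm cvfield"
    and Bs :: "nat \<Rightarrow> nat \<Rightarrow> nat \<Rightarrow> 'm \<Rightarrow> complex"
    and As At Bt Bu :: "nat \<Rightarrow> nat \<Rightarrow> nat \<Rightarrow> nat \<Rightarrow> 'm \<Rightarrow> complex"
    and B :: "'m \<Rightarrow> nat \<Rightarrow> nat \<Rightarrow> nat \<Rightarrow> nat \<Rightarrow> complex"
    and r Q :: "'m \<Rightarrow> nat \<Rightarrow> nat \<Rightarrow> complex" and s :: "'m \<Rightarrow> complex"
  assumes "ACR_manifold n A \<Phi> \<xi> g"
    and "levi_civita A g D"
    and "kenmotsu_type A \<Phi> \<xi> g D"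
    and "open U" and "adapted_frame_on n A \<Phi> \<xi> g U e"
    and "\<epsilon> = aframe n \<Phi> \<xi> e"
    and "structure_functions n A D U \<epsilon> Bs As At Bt Bu"
    and "B = gen_curv n A g D a0 a1 a2 \<epsilon>"
    and "r = ricci n A g D \<epsilon>" and "Q = ricci_op n A g D \<epsilon>" and "s = scalar_curv n A g D \<epsilon>"
  shows "\<forall>p\<in>U.
    (\<forall>a\<in>{1..n}. \<forall>b\<in>{1..n}.
       B p a 0 b 0 = of_real a1 * r p a b \<and>
       B p (hat n a) 0 b 0 =
         - (of_real a0 + 2 * of_nat n * of_real a1 - 2 * of_real a2 * s p) * kd a b
         + of_real a1 * r p (hat n a) b) \<and>
    (\<forall>a\<in>{1..n}. \<forall>b\<in>{1..n}. \<forall>c\<in>{1..n}. \<forall>d\<in>{1..n}.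
       B p (hat n a) b c d =
         2 * of_real a0 * As a b c d p + of_real a1 * (kd a c * r p b d - kd a d * r p b c) \<and>
       B p (hat n a) b c (hat n d) =
         of_real a0 * (At a d b c p - (\<Sum>h=1..n. Bs a h c p * cnj (Bs b h d p)))
         + of_real a1 * (kd a c * Q p d b + kd d b * Q p a c)
         + (2 * of_real a2 * s p - of_real a0) * kd a c * kd d b \<and>
       B p (hat n a) (hat n b) c d =
         2 * of_real a0 * alt2 (\<lambda>c d. Bt a b c d p) c d
         + 4 * of_real a1 * alt2 (\<lambda>a b. alt2 (\<lambda>c d. kd a c * Q p b d) c d) a b
         + 2 * (2 * of_real a2 * s p - of_real a0)
             * alt2 (\<lambda>a b. alt2 (\<lambda>c d. kd a c * kd b d) c d) a b) \<and>
    (\<forall>i\<le>2*n. \<forall>j\<le>2*n. \<forall>k\<le>2*n. \<forall>l\<le>2*n.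
       B p j i k l = - B p i j k l \<and>
       B p i j l k = - B p i j k l \<and>
       B p k l i j = B p i j k l \<and>
       B p i j k l + B p i k l j + B p i l j k = 0 \<and>
       B p (hat n i) (hat n j) (hat n k) (hat n l) = cnj (B p i j k l) \<and>
       ((i, j, k, l) \<notin> reachable n \<longrightarrow> B p i j k l = 0))"
proof (rule ballI, goal_cases)
  case (1 p)
  note p = this
  interpret kenmotsu_frame A g D U n \<Phi> \<xi> e
    by unfold_locales (use assms(1-5) in \<open>auto simp: ACR_manifold_def\<close>)
  interpret C: kenmotsu_components n "R_lo A g D \<epsilon> p"
    unfolding assms(6) by (rule R_lo_components[OF p])
  have r: "r p = C.ric" and s: "s p = C.scal" and Q: "Q p = C.ric_op"
    unfolding assms(9-11)
    by (simp_all add: fun_eq_iff C.ric_def C.scal_def C.ric_op_def ricci_def ricci_op_def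
        scalar_curv_def)
  have G: "g_lo g \<epsilon> p i j = C.G i j" if "i \<le> 2*n" "j \<le> 2*n" for i j
    using g_lo_aframe[OF p that] unfolding assms(6) C.G_def .
  have B: "B p i j k l = C.BC a0 a1 a2 i j k l" if "i \<le> 2*n" "j \<le> 2*n" "k \<le> 2*n" "l \<le> 2*n" for i j
      k l
    using that r s unfolding assms(8-11) gen_curv_def Let_def C.BC_def by (simp add: G)
  have le: "a \<le> 2*n" and hle: "hat n a \<le> 2*n" if "a \<in> {1..n}" for a
    using that by auto
  have le0: "0 \<le> 2*n" by simp
  \<comment> \<open>The relations for the structure functions concern \<open>R_up\<close>; lowering
    its first index a turns it into \<open>hat n a\<close>.\<close>
  have sf: "R_lo A g D \<epsilon> p (hat n a) (hat n b) c d =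
          2 * (alt2 (\<lambda>c d. Bt a b c d p) c d - alt2 (\<lambda>c d. kd a c * kd b d) c d)"
      "R_lo A g D \<epsilon> p (hat n a) b c d = 2 * As a b c d p"
      "R_lo A g D \<epsilon> p (hat n a) b c (hat n d) =
          At a d b c p - (\<Sum>h=1..n. Bs a h c p * cnj (Bs b h d p)) - kd a c * kd d b"
    if "a \<in> {1..n}" "b \<in> {1..n}" "c \<in> {1..n}" "d \<in> {1..n}" for a b c d
  proof -
    have ix: "a \<le> 2*n" "b \<le> 2*n" "c \<le> 2*n" "d \<le> 2*n" using that by auto
    note up = R_up_eq[OF p ix(1), folded assms(6), symmetric]
    note sf = assms(7)[unfolded structure_functions_def, THEN conjunct2, THEN bspec, OF p,
        THEN bspec, OF that(1), THEN bspec, OF that(2), THEN bspec, OF that(3), THEN bspec,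
            OF that(4)]
    show "R_lo A g D \<epsilon> p (hat n a) (hat n b) c d =
        2 * (alt2 (\<lambda>c d. Bt a b c d p) c d - alt2 (\<lambda>c d. kd a c * kd b d) c d)"
      using up[OF hat_simps(2)[OF ix(2)] ix(3,4)] sf by (elim conjE) (rule trans)
    show "R_lo A g D \<epsilon> p (hat n a) b c d = 2 * As a b c d p"
      using up[OF ix(2,3,4)] sf by (elim conjE) (rule trans)
    show "R_lo A g D \<epsilon> p (hat n a) b c (hat n d) =
        At a d b c p - (\<Sum>h=1..n. Bs a h c p * cnj (Bs b h d p)) - kd a c * kd d b"
      using up[OF ix(2,3) hat_simps(2)[OF ix(4)]] sf by (elim conjE) (rule trans)
  qed
  show ?case
  proof (intro conjI ballI allI impI, goal_cases)
    case (1 a b)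
    show ?case
      unfolding B[OF le[OF 1(1)] le0 le[OF 1(2)] le0] C.B_zero_components(1)[OF 1] r ..
  next
    case (2 a b)
    show ?case
      unfolding B[OF hle[OF 2(1)] le0 le[OF 2(2)] le0] C.B_zero_components(2)[OF 2] r s ..
  next
    case (3 a b c d)
    show ?case
      unfolding B[OF hle[OF 3(1)] 3(2-4)[THEN le]] C.B_components(1)[OF 3] r sf(2)[OF 3] by simp
  next
    case (4 a b c d)
    show ?case
      unfolding B[OF hle[OF 4(1)] 4(2,3)[THEN le] hle[OF 4(4)]] C.B_components(2)[OF 4] Q s
          sf(3)[OF 4]
      by (simp add: algebra_simps)
  next
    case (5 a b c d)
    \<comment> \<open>Antisymmetrised in c, d the product of deltas is already antisymmetric in a,
      b. This lets the term with a0 merge with the one containing the scalar curvature.\<close>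
    have alt: "alt2 (\<lambda>a b. alt2 (\<lambda>c d. kd a c * kd b d) c d) a b = alt2 (\<lambda>c d. kd a c * kd b d) c d"
      by (simp add: alt2_def field_simps)
    show ?case
      unfolding B[OF hle[OF 5(1)] hle[OF 5(2)] 5(3,4)[THEN le]] C.B_components(3)[OF 5] Q s
          sf(1)[OF 5] alt
      by (simp add: algebra_simps)
  next
    case (6 i j k l)
    show ?case unfolding B[OF 6(2,1,3,4)] B[OF 6] by (rule C.B_skew1[OF 6])
  next
    case (7 i j k l)
    show ?case unfolding B[OF 7(1,2,4,3)] B[OF 7] by (rule C.B_skew2[OF 7])
  next
    case (8 i j k l)
    show ?case unfolding B[OF 8(3,4,1,2)] B[OF 8] by (rule C.B_pair[OF 8])
  next
    case (9 i j k l)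
    show ?case
      unfolding B[OF 9] B[OF 9(1,3,4,2)] B[OF 9(1,4,2,3)] by (rule C.B_bianchi[OF 9])
  next
    case (10 i j k l)
    show ?case unfolding B[OF 10[THEN hat_simps(2)]] B[OF 10] by (rule C.B_conj[OF 10])
  next
    case (11 i j k l)
    show ?case unfolding B[OF 11(1-4)] by (rule C.B_unreachable[OF 11])
  qed
qed

end
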